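(* For every finite nilpotent group $G$ of class at most $2$ there exist abelian groups $A,B,C$ and a $\mathbb{Z}$-bilinear map $\mu\colon A\times B\to C$ such that the Heisenberg group $H(\mu)$ is non-degenerate, $G$ is isomorphic to a subgroup of $H(\mu)$, and $$d(G/Z(G))\ge\max\{d(A),d(B)\},\qquad d(Z(G))=d(C),$$ $$\exp(G/Z(G))\mid \exp(A\times B)\mid\exp(G')\mid\exp(Z(G))\mid\exp(C)\mid\exp(G).$$
   Context: For a group $G$, $d(G)$ is the smallest cardinality of a generating set, $\exp(G)$ the exponent, $Z(G)$ the centre, $G'$ the commutator subgroup. Heisenberg group: for abelian groups ($\mathbb{Z}$-modules) $A,B,C$ and a (not necessarily surjective) $\mathbb{Z}$-bilinear map $\mu\colon A\times B\to C$, $H(\mu)$ is the set $A\times B\times C$ with the group operation $$(a,b,c)*(a',b',c')=(a+a',\,b+b',\,c+\mu(a,b')+c'),$$ i.e. formal upper unitriangular matrices $\begin{pmatrix}1&a&c\\0&1&b\\0&0&1\end{pmatrix}$ multiplied via $\mu$. $H(\mu)$ is called non-degenerate if $Z(H(\mu))=\{(0,0,c):c\in C\}$; equivalently, $\mu(a,B)=0$ implies $a=0$ and $\mu(A,b)=0$ implies $b=0$. *)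

theory Defs
  imports "HOL-Algebra.Algebra" "HOL-Library.Extended_Nat"
begin

definition center :: "('a, 'm) monoid_scheme \<Rightarrow> 'a set" where
  "center G = {z \<in> carrier G. \<forall>x \<in> carrier G. z \<otimes>\<^bsub>G\<^esub> x = x \<otimes>\<^bsub>G\<^esub> z}"

text \<open>All infinite cardinalities are identified with \<open>\<infinity>\<close>.\<close>

definition gen_rank :: "('a, 'm) monoid_scheme \<Rightarrow> enat" where
  "gen_rank G = (INF S \<in> {S. S \<subseteq> carrier G \<and> generate G S = carrier G}.
     if finite S then enat (card S) else \<infinity>)"

text \<open>The value is \<open>0\<close> for groups of infinite exponent.\<close>

definition group_exponent :: "('a, 'm) monoid_scheme \<Rightarrow> nat" where
  "group_exponent G =
     (if \<exists>n>0. \<forall>x \<in> carrier G. x [^]\<^bsub>G\<^esub> (n::nat) = \<one>\<^bsub>G\<^esub>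
      then LEAST n. n > 0 \<and> (\<forall>x \<in> carrier G. x [^]\<^bsub>G\<^esub> n = \<one>\<^bsub>G\<^esub>)
      else 0)"

text \<open>The series is indexed from \<open>0\<close>, so that the class is the first index at which
  it is trivial.\<close>

primrec lower_central :: "('a, 'm) monoid_scheme \<Rightarrow> nat \<Rightarrow> 'a set" where
  "lower_central G 0 = carrier G"
| "lower_central G (Suc n) = generate G
     (\<Union>x \<in> lower_central G n. \<Union>y \<in> carrier G.
        {x \<otimes>\<^bsub>G\<^esub> y \<otimes>\<^bsub>G\<^esub> inv\<^bsub>G\<^esub> x \<otimes>\<^bsub>G\<^esub> inv\<^bsub>G\<^esub> y})"

definition nilpotent :: "('a, 'm) monoid_scheme \<Rightarrow> bool" where
  "nilpotent G \<longleftrightarrow> group G \<and> (\<exists>n. lower_central G n = {\<one>\<^bsub>G\<^esub>})"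

definition nilpotency_class :: "('a, 'm) monoid_scheme \<Rightarrow> nat" where
  "nilpotency_class G = (LEAST n. lower_central G n = {\<one>\<^bsub>G\<^esub>})"

text \<open>Abelian groups are multiplicative \<^locale>\<open>comm_group\<close> records, so the additive
  formulas for bilinearity and for the Heisenberg multiplication appear with \<open>\<otimes>\<close>.\<close>

definition bilinear ::
  "'a monoid \<Rightarrow> 'b monoid \<Rightarrow> 'c monoid \<Rightarrow> ('a \<Rightarrow> 'b \<Rightarrow> 'c) \<Rightarrow> bool" where
  "bilinear A B C \<mu> \<longleftrightarrow>
     (\<forall>a \<in> carrier A. (\<lambda>b. \<mu> a b) \<in> hom B C) \<and>
     (\<forall>b \<in> carrier B. (\<lambda>a. \<mu> a b) \<in> hom A C)"

definition heisenberg ::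
  "'a monoid \<Rightarrow> 'b monoid \<Rightarrow> 'c monoid \<Rightarrow> ('a \<Rightarrow> 'b \<Rightarrow> 'c) \<Rightarrow> ('a \<times> 'b \<times> 'c) monoid" where
  "heisenberg A B C \<mu> =
     \<lparr>carrier = carrier A \<times> carrier B \<times> carrier C,
      monoid.mult = (\<lambda>(a, b, c) (a', b', c').
        (a \<otimes>\<^bsub>A\<^esub> a', b \<otimes>\<^bsub>B\<^esub> b', c \<otimes>\<^bsub>C\<^esub> \<mu> a b' \<otimes>\<^bsub>C\<^esub> c')),
      one = (\<one>\<^bsub>A\<^esub>, \<one>\<^bsub>B\<^esub>, \<one>\<^bsub>C\<^esub>)\<rparr>"

definition nondegenerate ::
  "'a monoid \<Rightarrow> 'b monoid \<Rightarrow> 'c monoid \<Rightarrow> ('a \<Rightarrow> 'b \<Rightarrow> 'c) \<Rightarrow> bool" where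
  "nondegenerate A B C \<mu> \<longleftrightarrow>
     center (heisenberg A B C \<mu>) = {(\<one>\<^bsub>A\<^esub>, \<one>\<^bsub>B\<^esub>, c) |c. c \<in> carrier C}"

lemma group_heisenberg:
  assumes "comm_group A" "comm_group B" "comm_group C" "bilinear A B C \<mu>"
  shows "group (heisenberg A B C \<mu>)"
proof -
  interpret A: comm_group A by fact
  interpret B: comm_group B by fact
  interpret C: comm_group C by fact
  have homB: "\<mu> a \<in> hom B C" if "a \<in> carrier A" for a
    using assms(4) that by (auto simp: bilinear_def)
  have homA: "(\<lambda>a. \<mu> a b) \<in> hom A C" if "b \<in> carrier B" for b
    using assms(4) that by (auto simp: bilinear_def)
  have clo [simp]: "\<mu> a b \<in> carrier C" if "a \<in> carrier A" "b \<in> carrier B" for a b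
    using homB[OF that(1)] that(2) by (auto simp: hom_def)
  have addB: "\<mu> a (b \<otimes>\<^bsub>B\<^esub> b') = \<mu> a b \<otimes>\<^bsub>C\<^esub> \<mu> a b'"
    if "a \<in> carrier A" "b \<in> carrier B" "b' \<in> carrier B" for a b b'
    using homB[OF that(1)] that by (auto simp: hom_def)
  have addA: "\<mu> (a \<otimes>\<^bsub>A\<^esub> a') b = \<mu> a b \<otimes>\<^bsub>C\<^esub> \<mu> a' b"
    if "a \<in> carrier A" "a' \<in> carrier A" "b \<in> carrier B" for a a' b
    using homA[OF that(3)] that by (auto simp: hom_def)
  have oneA: "\<mu> \<one>\<^bsub>A\<^esub> b = \<one>\<^bsub>C\<^esub>" if "b \<in> carrier B" for b
    using group_hom.hom_one[of A C "\<lambda>a. \<mu> a b"] homA[OF that]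
    by (simp add: group_hom_def group_hom_axioms_def A.is_group C.is_group)
  show ?thesis
  proof (rule groupI)
    fix x assume "x \<in> carrier (heisenberg A B C \<mu>)"
    then obtain a b c where x: "x = (a, b, c)"
      and abc: "a \<in> carrier A" "b \<in> carrier B" "c \<in> carrier C"
      by (auto simp: heisenberg_def)
    let ?y = "(inv\<^bsub>A\<^esub> a, inv\<^bsub>B\<^esub> b, inv\<^bsub>C\<^esub> (\<mu> (inv\<^bsub>A\<^esub> a) b \<otimes>\<^bsub>C\<^esub> c))"
    show "\<exists>y \<in> carrier (heisenberg A B C \<mu>).
        y \<otimes>\<^bsub>heisenberg A B C \<mu>\<^esub> x = \<one>\<^bsub>heisenberg A B C \<mu>\<^esub>"
      by (rule bexI[of _ ?y]) (use abc in \<open>simp_all add: x heisenberg_def C.m_assoc\<close>)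
  qed (auto simp: heisenberg_def addA addB oneA A.m_assoc B.m_assoc C.m_ac)
qed

end

theory Submission
  imports Defs
begin

text \<open>
  Let \<open>Z\<close> be the centre of \<open>G\<close>. The commutator is an alternating bilinear map on the finite abelian
  group \<open>G / Z\<close>; decomposing \<open>G / Z\<close> into cyclic factors and keeping only the part above the
  diagonal writes it as \<open>[x, y] = m(x, y) m(y, x)\<inverse>\<close> with \<open>m\<close> bilinear and with values in \<open>G'\<close>.
  Then \<open>x * y = x y m(x, y)\<inverse>\<close> is an abelian group structure \<open>E\<close> on the set \<open>G\<close> with subgroup \<open>Z\<close>. Put
  \<open>n = exp G\<close>. Expanding \<open>(x y)\<^sup>n\<close> gives \<open>[x, y]\<close> to the power \<open>n (n - 1) / 2\<close> equal to \<open>1\<close>, and therefore \<open>E\<close>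
  has exponent dividing \<open>n\<close>. Embed \<open>Z\<close> into \<open>C = (\<int>/n)\<^sup>d\<close> with \<open>d = d(Z)\<close> and extend this to a homomorphism
  \<open>\<kappa>\<close> from \<open>E\<close> to \<open>C\<close>, which is possible because \<open>\<int>/n\<close> is injective among abelian groups of exponent
  dividing \<open>n\<close>. Dividing \<open>G\<close> by the left and by the right radical of \<open>m\<close> gives \<open>A\<close> and \<open>B\<close>, the map
  induced by \<open>\<kappa> \<circ> m\<close> is non-degenerate, and \<open>x \<mapsto> (x, x, \<kappa> x)\<close> is the embedding. It is injective since
  an element in both radicals is central.
\<close>

section \<open>Splitting off cyclic factors\<close>

text \<open>Commutativity allows all occurrences of \<open>x\<close> in a word to be collected in
  front.\<close>

lemma (in comm_group) mem_generate_insert: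
  assumes "x \<in> carrier G" "T \<subseteq> carrier G"
  shows "y \<in> generate G (insert x T) \<longleftrightarrow> (\<exists>i::int. \<exists>w\<in>generate G T. y = x [^] i \<otimes> w)"
proof
  have x: "x \<in> generate G (insert x T)" by (simp add: generate.incl)
  have sub: "subgroup (generate G (insert x T)) G"
    using assms by (simp add: generate_is_subgroup)
  show "y \<in> generate G (insert x T)" if "\<exists>i::int. \<exists>w\<in>generate G T. y = x [^] i \<otimes> w"
    using that subgroup_int_pow_closed[OF sub x] mono_generate[of T "insert x T"]
    by (auto intro: generate.eng)
next
  note [simp] = generate_in_carrier[OF assms(2)]
  assume "y \<in> generate G (insert x T)"
  then show "\<exists>i::int. \<exists>w\<in>generate G T. y = x [^] i \<otimes> w"
  proof (induction rule: generate.induct)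
    case one
    show ?case by (intro exI[of _ "0::int"] bexI[of _ \<one>]) (auto intro: generate.one)
  next
    case (incl h)
    show ?case
    proof (cases "h = x")
      case True
      then show ?thesis
        using assms by (intro exI[of _ "1::int"] bexI[of _ \<one>]) (auto intro: generate.one)
    next
      case False
      then show ?thesis
        using incl assms by (intro exI[of _ "0::int"] bexI[of _ h]) (auto intro: generate.incl)
    qed
  next
    case (inv h)
    show ?case
    proof (cases "h = x")
      case True
      then show ?thesis
        using assms by (intro exI[of _ "-1::int"] bexI[of _ \<one>]) (auto intro: generate.one simp: int_pow_neg)
    next
      case False
      then show ?thesis
        using inv assms by (intro exI[of _ "0::int"] bexI[of _ "inv h"]) (auto intro: generate.inv)
    qed
  next
    case (eng h1 h2)
    then obtain i j :: int and v w
      where vw: "v \<in> generate G T" "w \<in> generate G T" "h1 = x [^] i \<otimes> v" "h2 = x [^] j \<otimes> w"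
      by blast
    have "h1 \<otimes> h2 = x [^] (i + j) \<otimes> (v \<otimes> w)"
      using vw assms by (simp add: int_pow_mult m_ac)
    then show ?case using vw by (blast intro: generate.eng)
  qed
qed

text \<open>The change of generators by which \<open>cyclic_split\<close> corrects \<open>x\<close>:
  a factor from the span of \<open>T\<close> can be divided out again.\<close>

lemma (in comm_group) generate_insert_mult:
  assumes "x \<in> carrier G" "T \<subseteq> carrier G" "w \<in> generate G T"
  shows "generate G (insert (x \<otimes> w) T) = generate G (insert x T)"
proof -
  have w: "w \<in> carrier G" using assms generate_in_carrier by blast
  have sub: "subgroup (generate G (insert y T)) G" if "y \<in> carrier G" for y
    using assms that by (simp add: generate_is_subgroup)
  have mem: "T \<subseteq> generate G (insert y T)" "y \<in> generate G (insert y T)"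
    "w \<in> generate G (insert y T)" for y
    using mono_generate[of T "insert y T"] assms(3) by (auto intro: generate.incl)
  have "x = (x \<otimes> w) \<otimes> inv w" using assms w by (simp add: m_assoc)
  moreover have "(x \<otimes> w) \<otimes> inv w \<in> generate G (insert (x \<otimes> w) T)"
    using assms w by (intro generate.eng[OF mem(2)] subgroup.m_inv_closed[OF sub] mem(3)) simp
  ultimately have 1: "x \<in> generate G (insert (x \<otimes> w) T)" by simp
  have 2: "x \<otimes> w \<in> generate G (insert x T)" using mem by (intro generate.eng)
  show ?thesis
    using 1 2 mem(1) assms(1) w by (intro equalityI generate_subgroup_incl sub) auto
qed

text \<open>
  Among all generating tuples and all relations between their members, take a positive exponent
  \<open>t\<close> that is as small as possible. Then \<open>t\<close> divides the other exponents of its relation, since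
  division with remainder would give a smaller one, and a change of the first generator
  makes its \<open>t\<close>-th power trivial.
\<close>

lemma (in comm_group) cyclic_split:
  assumes fin: "finite (carrier G)" and S: "finite S" "S \<subseteq> carrier G" "card S \<le> Suc k"
  obtains x T where "x \<in> carrier G" "finite T" "T \<subseteq> carrier G" "card T \<le> k"
    "generate G (insert x T) = generate G S"
    "\<And>i::int. x [^] i \<in> generate G T \<Longrightarrow> x [^] i = \<one>"
proof -
  define R where "R = (\<lambda>(t::nat) x T. 0 < t \<and> x \<in> carrier G \<and> finite T \<and> T \<subseteq> carrier G \<and> card T \<le> k \<and>
    generate G (insert x T) = generate G S \<and> x [^] t \<in> generate G T)"
  have "\<exists>t x T. R t x T"
  proof (cases "S = {}")
    case True
    \<comment> \<open>With nothing to split, the identity serves as generator, with exponent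
      1.\<close>
    then show ?thesis unfolding R_def
      by (intro exI[of _ "1::nat"] exI[of _ \<one>] exI[of _ "{}"]) (auto simp: generate_one generate_empty)
  next
    case False
    then obtain x where x: "x \<in> S" by blast
    \<comment> \<open>The group order is a first admissible exponent: the power is trivial and so
      lies in any span.\<close>
    have "x [^] order G = \<one>" "0 < order G"
      using x S fin pow_order_eq_1 order_gt_0_iff_finite by auto
    then show ?thesis unfolding R_def using x S
      by (intro exI[of _ "order G"] exI[of _ x] exI[of _ "S - {x}"])
        (auto simp: insert_absorb intro: generate.one)
  qed
  define t where "t = (LEAST t. \<exists>x T. R t x T)"
  have ex: "\<exists>x T. R t x T" unfolding t_def by (rule LeastI_ex) fact
  then obtain x0 T where T: "R t x0 T" by blast
  have least: "\<not> R r y Y" if "r < t" for r y Y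
    using not_less_Least[of r "\<lambda>t. \<exists>x T. R t x T"] that by (auto simp: t_def)
  have t0: "0 < t" and fT: "finite T" "T \<subseteq> carrier G" "card T \<le> k"
    using T by (auto simp: R_def)
  \<comment> \<open>The members of \<open>T\<close> are cleared from \<open>x [^] t\<close> one
    after another, and \<open>U\<close> collects those already gone. Only \<open>x\<close> changes;
    \<open>t\<close>, \<open>T\<close> and the span of \<open>x\<close> and \<open>T\<close>
    stay.\<close>
  have step: "\<exists>x\<in>carrier G. generate G (insert x T) = generate G S \<and> x [^] t \<in> generate G (T - U)"
    if "finite U" "U \<subseteq> T" for U
    using that
  proof (induction U rule: finite_induct)
    case empty
    then show ?case using T by (auto simp: R_def)
  next
    case (insert y U)
    then obtain x where x: "x \<in> carrier G" "generate G (insert x T) = generate G S"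
        "x [^] t \<in> generate G (T - U)" by auto
    define W where "W = T - insert y U"
    have W: "W \<subseteq> carrier G" "W \<subseteq> T - {y}" using fT by (auto simp: W_def)
    have y: "y \<in> T" "y \<in> carrier G" using insert fT by auto
    have TU: "T - U = insert y W" using insert by (auto simp: W_def)
    then obtain m :: int and w where w: "w \<in> generate G W" "x [^] t = y [^] m \<otimes> w"
      using x(3) mem_generate_insert[OF y(2) W(1)] by auto
    have wc: "w \<in> carrier G" using w W generate_in_carrier by blast
    \<comment> \<open>The correction by \<open>y [^] (- q)\<close> lowers the exponent of
      \<open>y\<close> in the \<open>t\<close>-th power from \<open>m\<close> to the remainder
      \<open>r\<close>.\<close>
    define q where "q = m div int t"
    define r where "r = nat (m mod int t)"
    have m: "m - q * int t = int r" using t0 by (simp add: q_def r_def minus_div_mult_eq_mod)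
    have r: "r < t" using t0 by (simp add: r_def nat_less_iff)
    define x' where "x' = x \<otimes> y [^] (- q)"
    have x'c: "x' \<in> carrier G" using x y by (simp add: x'_def)
    have "y [^] (- q) \<in> generate G T"
      using y by (intro subgroup_int_pow_closed generate_is_subgroup fT generate.incl)
    then have gen': "generate G (insert x' T) = generate G S"
      using generate_insert_mult x fT unfolding x'_def by blast
    have "x' [^] int t = x [^] int t \<otimes> y [^] (- (q * int t))"
      using x(1) y(2) by (simp add: x'_def int_pow_distrib int_pow_pow)
    then have "x' [^] t = x [^] t \<otimes> y [^] (- (q * int t))" by (simp add: int_pow_int)
    also have "\<dots> = y [^] (m - q * int t) \<otimes> w"
      using y(2) wc int_pow_mult[OF y(2), of m "- (q * int t)"] by (simp add: w(2) m_ac)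
    finally have pow: "x' [^] t = y [^] r \<otimes> w" by (simp add: m int_pow_int)
    \<comment> \<open>Otherwise \<open>y\<close> and \<open>x'\<close> exchange roles:
      \<open>y [^] r\<close> lies in the span of \<open>x'\<close> and the rest of \<open>T\<close>,
      against the minimality of \<open>t\<close>.\<close>
    have "r = 0"
    proof (rule ccontr)
      assume "r \<noteq> 0"
      let ?Y = "insert x' (T - {y})"
      have Y: "?Y \<subseteq> carrier G" using x'c fT by auto
      have "w \<in> generate G ?Y" using w W mono_generate[of W ?Y] by auto
      moreover have "x' \<in> generate G ?Y" by (simp add: generate.incl)
      then have "x' [^] t \<in> generate G ?Y"
        using subgroup_int_pow_closed[OF generate_is_subgroup[OF Y], of x' "int t"] by (simp add: int_pow_int)
      ultimately have "x' [^] t \<otimes> inv w \<in> generate G ?Y"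
        using generate_is_subgroup[OF Y] by (auto intro: generate.eng subgroup.m_inv_closed)
      moreover have "x' [^] t \<otimes> inv w = y [^] r" using wc y by (simp add: pow m_assoc)
      ultimately have "y [^] r \<in> generate G ?Y" by simp
      moreover have "insert y ?Y = insert x' T" using y by auto
      moreover have "card ?Y \<le> k"
        using fT card_Suc_Diff1[OF fT(1) y(1)] by (simp only: card_insert_if finite_Diff split: if_splits) auto
      ultimately have "R r y ?Y"
        using \<open>r \<noteq> 0\<close> y fT Y gen' by (simp add: R_def)
      then show False using least r by blast
    qed
    then show ?case using pow wc w(1) x'c gen' by (auto simp: W_def)
  qed
  obtain x where x: "x \<in> carrier G" "generate G (insert x T) = generate G S" "x [^] t = \<one>"
    using step[OF fT(1) order_refl] by (auto simp: generate_empty)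
  show thesis
  proof (rule that[OF x(1) fT x(2)])
    fix i :: int assume i: "x [^] i \<in> generate G T"
    \<comment> \<open>As \<open>x [^] t\<close> is trivial, only \<open>i\<close> modulo
      \<open>t\<close> matters; a nonzero remainder would again be an exponent below
      \<open>t\<close>.\<close>
    define r where "r = nat (i mod int t)"
    have r: "r < t" "i = i div int t * int t + int r" using t0 by (auto simp: r_def nat_less_iff)
    have "x [^] i = (x [^] int t) [^] (i div int t) \<otimes> x [^] int r"
      using x(1) by (subst r(2)) (simp add: int_pow_mult int_pow_pow mult.commute)
    then have eq: "x [^] i = x [^] r" using x by (simp add: int_pow_int)
    then have "r = 0" using least[OF r(1), of x T] i x fT by (auto simp: R_def)
    then show "x [^] i = \<one>" using eq by simp
  qed
qed

text \<open>The span of \<open>x\<close> and \<open>T\<close> is the internal direct product of the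
  spans of \<open>x\<close> and of \<open>T\<close>, and \<open>q\<close> is the projection to the
  second. The exponent \<open>j u\<close> is determined only modulo the order of \<open>x\<close>,
  so additivity is stated for \<open>x [^] j u\<close>.\<close>

lemma (in comm_group) cyclic_split_projections:
  assumes x: "x \<in> carrier G" and T: "T \<subseteq> carrier G"
    and indep: "\<And>i::int. x [^] i \<in> generate G T \<Longrightarrow> x [^] i = \<one>"
  obtains j :: "'a \<Rightarrow> int" and q
  where "\<And>u. u \<in> generate G (insert x T) \<Longrightarrow> q u \<in> generate G T"
    "\<And>u. u \<in> generate G (insert x T) \<Longrightarrow> x [^] j u \<otimes> q u = u"
    "\<And>u v. u \<in> generate G (insert x T) \<Longrightarrow> v \<in> generate G (insert x T) \<Longrightarrow>
       x [^] j (u \<otimes> v) = x [^] j u \<otimes> x [^] j v"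
    "\<And>u v. u \<in> generate G (insert x T) \<Longrightarrow> v \<in> generate G (insert x T) \<Longrightarrow>
       q (u \<otimes> v) = q u \<otimes> q v"
proof -
  let ?H = "generate G (insert x T)"
  have "\<forall>u\<in>?H. \<exists>p. snd p \<in> generate G T \<and> u = x [^] (fst p :: int) \<otimes> snd p"
    using mem_generate_insert[OF x T] by fastforce
  then obtain p where p: "\<And>u. u \<in> ?H \<Longrightarrow> snd (p u) \<in> generate G T \<and> u = x [^] (fst (p u) :: int) \<otimes> snd (p u)"
    by metis
  define j where "j = fst \<circ> p"
  define q where "q = snd \<circ> p"
  have q: "q u \<in> generate G T" "u = x [^] j u \<otimes> q u" if "u \<in> ?H" for u
    using p[OF that] by (auto simp: j_def q_def)
  note gc = generate_in_carrier[OF T]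
  \<comment> \<open>Two decompositions of one element differ by a power of \<open>x\<close> in the
    span of \<open>T\<close>, which is trivial by \<open>indep\<close>.\<close>
  have uniq: "x [^] i = x [^] i' \<and> w = w'"
    if "x [^] i \<otimes> w = x [^] i' \<otimes> w'" "w \<in> generate G T" "w' \<in> generate G T" for i i' :: int and w w'
  proof -
    have c: "w \<in> carrier G" "w' \<in> carrier G" using that gc by auto
    have "x [^] (i - i') = inv (x [^] i') \<otimes> x [^] i"
      using x by (simp add: int_pow_diff m_comm)
    also have "\<dots> = inv (x [^] i') \<otimes> (x [^] i \<otimes> w) \<otimes> inv w"
      using x c by (simp add: m_assoc)
    also have "\<dots> = w' \<otimes> inv w" using x c by (simp add: that(1) flip: m_assoc)
    also have "\<dots> \<in> generate G T"
      using that generate_is_subgroup[OF T] by (auto intro: generate.eng subgroup.m_inv_closed)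
    finally have 1: "x [^] (i - i') = \<one>" using indep by blast
    then have "x [^] i = x [^] i'" using x
      by (metis add_diff_cancel_right' diff_add_cancel int_pow_closed int_pow_mult l_one)
    then show ?thesis using that(1) x c by simp
  qed
  have mult: "x [^] j (u \<otimes> v) = x [^] (j u + j v) \<and> q (u \<otimes> v) = q u \<otimes> q v"
    if "u \<in> ?H" "v \<in> ?H" for u v
  proof (rule uniq)
    have "u \<otimes> v = (x [^] j u \<otimes> q u) \<otimes> (x [^] j v \<otimes> q v)" using q that by simp
    also have "\<dots> = x [^] (j u + j v) \<otimes> (q u \<otimes> q v)"
      using x gc q(1) that by (simp add: int_pow_mult m_ac)
    finally show "x [^] j (u \<otimes> v) \<otimes> q (u \<otimes> v) = x [^] (j u + j v) \<otimes> (q u \<otimes> q v)"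
      using q(2)[of "u \<otimes> v"] generate.eng[OF that] by metis
  qed (use q that in \<open>auto intro: generate.eng\<close>)
  show thesis by (rule that[of q j]) (use q(1) q(2)[symmetric] mult x in \<open>auto simp: int_pow_mult\<close>)
qed

text \<open>Induction on the number of generators. Splitting off a cyclic factor cuts
  \<open>b\<close> into blocks; \<open>\<mu>\<close> keeps the block pairing the cyclic factor with
  the rest, in this order, and the induction hypothesis treats the rest. The last clause presents
  \<open>b u v\<close> as the quotient of \<open>\<mu> u v\<close> by \<open>\<mu> v u\<close>
  without writing an inverse.\<close>

lemma (in comm_group) alternating_eq_bilinear_diff_generate:
  fixes M (structure)
  assumes fin: "finite (carrier G)" and M: "comm_group M"
    and homr: "\<And>x. x \<in> carrier G \<Longrightarrow> b x \<in> hom G M"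
    and homl: "\<And>y. y \<in> carrier G \<Longrightarrow> (\<lambda>x. b x y) \<in> hom G M"
    and alt: "\<And>x. x \<in> carrier G \<Longrightarrow> b x x = \<one>\<^bsub>M\<^esub>"
    and T: "finite T" "T \<subseteq> carrier G" "card T \<le> k"
  shows "\<exists>\<mu>. (\<forall>u\<in>generate G T. \<mu> u \<in> hom (G\<lparr>carrier := generate G T\<rparr>) M) \<and>
    (\<forall>v\<in>generate G T. (\<lambda>u. \<mu> u v) \<in> hom (G\<lparr>carrier := generate G T\<rparr>) M) \<and>
    (\<forall>u\<in>generate G T. \<forall>v\<in>generate G T. \<mu> u v = b u v \<otimes>\<^bsub>M\<^esub> \<mu> v u)"
  using T
proof (induction k arbitrary: T)
  case 0
  interpret M: comm_group M by fact
  have "T = {}" using 0 by auto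
  then show ?case
    using alt by (intro exI[of _ "\<lambda>_ _. \<one>\<^bsub>M\<^esub>"]) (auto simp: generate_empty hom_def)
next
  case (Suc k)
  interpret M: comm_group M by fact
  obtain x T' where x: "x \<in> carrier G" and T': "finite T'" "T' \<subseteq> carrier G" "card T' \<le> k"
    and gen: "generate G (insert x T') = generate G T"
    and indep: "\<And>i::int. x [^] i \<in> generate G T' \<Longrightarrow> x [^] i = \<one>"
    using cyclic_split[OF fin Suc.prems(1,2,3)] by metis
  obtain j :: "'a \<Rightarrow> int" and q
    where q: "\<And>u. u \<in> generate G T \<Longrightarrow> q u \<in> generate G T'"
    and dec: "\<And>u. u \<in> generate G T \<Longrightarrow> x [^] j u \<otimes> q u = u"
    and jm: "\<And>u v. u \<in> generate G T \<Longrightarrow> v \<in> generate G T \<Longrightarrow>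
       x [^] j (u \<otimes> v) = x [^] j u \<otimes> x [^] j v"
    and qm: "\<And>u v. u \<in> generate G T \<Longrightarrow> v \<in> generate G T \<Longrightarrow> q (u \<otimes> v) = q u \<otimes> q v"
    using cyclic_split_projections[OF x T'(2) indep] unfolding gen by metis
  obtain \<nu> where \<nu>r: "\<And>u. u \<in> generate G T' \<Longrightarrow> \<nu> u \<in> hom (G\<lparr>carrier := generate G T'\<rparr>) M"
    and \<nu>l: "\<And>v. v \<in> generate G T' \<Longrightarrow> (\<lambda>u. \<nu> u v) \<in> hom (G\<lparr>carrier := generate G T'\<rparr>) M"
    and \<nu>: "\<And>u v. u \<in> generate G T' \<Longrightarrow> v \<in> generate G T' \<Longrightarrow> \<nu> u v = b u v \<otimes>\<^bsub>M\<^esub> \<nu> v u"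
    using Suc.IH[OF T'] by metis
  have gc [simp]: "u \<in> carrier G" if "u \<in> generate G T'" for u
    using generate_in_carrier[OF T'(2) that] .
  have b_closed [simp]: "b u v \<in> carrier M" if "u \<in> carrier G" "v \<in> carrier G" for u v
    using homr[OF that(1)] that by (auto simp: hom_def)
  have br: "b u (v \<otimes> w) = b u v \<otimes>\<^bsub>M\<^esub> b u w"
    if "u \<in> carrier G" "v \<in> carrier G" "w \<in> carrier G" for u v w
    using homr[OF that(1)] that by (auto simp: hom_def)
  have bl: "b (u \<otimes> v) w = b u w \<otimes>\<^bsub>M\<^esub> b v w"
    if "u \<in> carrier G" "v \<in> carrier G" "w \<in> carrier G" for u v w
    using homl[OF that(3)] that by (auto simp: hom_def)
  \<comment> \<open>Expanding \<open>b\<close> with \<open>u \<otimes> v\<close> in both arguments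
    leaves only the two mixed terms.\<close>
  have anti: "b u v \<otimes>\<^bsub>M\<^esub> b v u = \<one>\<^bsub>M\<^esub>" if "u \<in> carrier G" "v \<in> carrier G" for u v
    using alt[of "u \<otimes> v"] that by (simp add: br bl alt[OF that(1)] alt[OF that(2)] M.m_comm)
  \<comment> \<open>The value is a power of \<open>b x x\<close>, so the cyclic factor has no
    diagonal block.\<close>
  have iso: "b (x [^] (i::int)) (x [^] (l::int)) = \<one>\<^bsub>M\<^esub>" for i l
    using x hom_int_pow[OF homr, of "x [^] i" x l] hom_int_pow[OF homl, of x x i]
    by (simp add: alt M.is_group)
  have \<nu>_closed [simp]: "\<nu> u v \<in> carrier M" if "u \<in> generate G T'" "v \<in> generate G T'" for u v
    using \<nu>r[OF that(1)] that by (auto simp: hom_def)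
  have \<nu>mr: "\<nu> u (v \<otimes> w) = \<nu> u v \<otimes>\<^bsub>M\<^esub> \<nu> u w"
    if "u \<in> generate G T'" "v \<in> generate G T'" "w \<in> generate G T'" for u v w
    using \<nu>r[OF that(1)] that by (auto simp: hom_def)
  have \<nu>ml: "\<nu> (u \<otimes> v) w = \<nu> u w \<otimes>\<^bsub>M\<^esub> \<nu> v w"
    if "u \<in> generate G T'" "v \<in> generate G T'" "w \<in> generate G T'" for u v w
    using \<nu>l[OF that(3)] that by (auto simp: hom_def)
  \<comment> \<open>The block \<open>b (q u) (x [^] j v)\<close> below the diagonal is dropped.\<close>
  define \<mu> where "\<mu> = (\<lambda>u v. b (x [^] j u) (q v) \<otimes>\<^bsub>M\<^esub> \<nu> (q u) (q v))"
  have skew: "\<mu> u v = b u v \<otimes>\<^bsub>M\<^esub> \<mu> v u" if "u \<in> generate G T" "v \<in> generate G T" for u v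
  proof -
    let ?X = "x [^] j u" and ?X' = "x [^] j v"
    have "b u v = b (?X \<otimes> q u) (?X' \<otimes> q v)" using dec that by simp
    also have "\<dots> = b ?X (q v) \<otimes>\<^bsub>M\<^esub> b (q u) ?X' \<otimes>\<^bsub>M\<^esub> b (q u) (q v)"
      using x q that by (simp add: bl br iso M.m_ac)
    finally have "b u v \<otimes>\<^bsub>M\<^esub> \<mu> v u = b ?X (q v) \<otimes>\<^bsub>M\<^esub> (b (q u) ?X' \<otimes>\<^bsub>M\<^esub> b ?X' (q u)) \<otimes>\<^bsub>M\<^esub>
        (b (q u) (q v) \<otimes>\<^bsub>M\<^esub> \<nu> (q v) (q u))"
      using x q that by (simp add: \<mu>_def M.m_ac)
    \<comment> \<open>The mixed pair cancels by \<open>anti\<close>; the induction hypothesis merges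
      the last two factors.\<close>
    also have "\<dots> = \<mu> u v"
      using x q that by (simp add: \<mu>_def anti flip: \<nu>)
    finally show ?thesis by simp
  qed
  show ?case
  proof (intro exI[of _ \<mu>] conjI ballI)
    fix u assume u: "u \<in> generate G T"
    show "\<mu> u \<in> hom (G\<lparr>carrier := generate G T\<rparr>) M"
      using u x q by (auto simp: hom_def \<mu>_def qm br \<nu>mr M.m_ac)
    show "(\<lambda>v. \<mu> v u) \<in> hom (G\<lparr>carrier := generate G T\<rparr>) M"
      using u x q by (auto simp: hom_def \<mu>_def qm jm bl \<nu>ml M.m_ac)
  qed (rule skew)
qed

lemma (in comm_group) alternating_eq_bilinear_diff:
  fixes M (structure)
  assumes fin: "finite (carrier G)" and M: "comm_group M"
    and homr: "\<And>x. x \<in> carrier G \<Longrightarrow> b x \<in> hom G M"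
    and homl: "\<And>y. y \<in> carrier G \<Longrightarrow> (\<lambda>x. b x y) \<in> hom G M"
    and alt: "\<And>x. x \<in> carrier G \<Longrightarrow> b x x = \<one>\<^bsub>M\<^esub>"
  obtains \<mu> where "\<And>u. u \<in> carrier G \<Longrightarrow> \<mu> u \<in> hom G M"
    "\<And>v. v \<in> carrier G \<Longrightarrow> (\<lambda>u. \<mu> u v) \<in> hom G M"
    "\<And>u v. u \<in> carrier G \<Longrightarrow> v \<in> carrier G \<Longrightarrow> \<mu> u v = b u v \<otimes>\<^bsub>M\<^esub> \<mu> v u"
proof -
  have "generate G (carrier G) = carrier G"
    using generate_incl[OF order_refl] by (auto intro: generate.incl)
  then have "G\<lparr>carrier := generate G (carrier G)\<rparr> = G" by simp
  note aux = alternating_eq_bilinear_diff_generate[OF fin M homr homl alt fin order_refl order_refl, unfolded this]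
  from aux \<open>generate G (carrier G) = carrier G\<close> show thesis
    using that by metis
qed

section \<open>Characters of finite abelian groups\<close>

text \<open>One character for each cyclic factor: a cyclic group whose order divides
  \<open>n\<close> embeds into the integers modulo \<open>n\<close>. The number of characters is the
  number of generators, and this later becomes the rank of \<open>C\<close>.\<close>

lemma (in comm_group) separating_characters:
  assumes fin: "finite (carrier G)" and n: "0 < n" "\<And>x. x \<in> carrier G \<Longrightarrow> x [^] n = \<one>"
    and T: "finite T" "T \<subseteq> carrier G" "card T \<le> k"
  shows "\<exists>\<chi>. (\<forall>i<k. \<chi> i \<in> hom (G\<lparr>carrier := generate G T\<rparr>) (integer_mod_group n)) \<and>
    (\<forall>u\<in>generate G T. (\<forall>i<k. \<chi> i u = 0) \<longrightarrow> u = \<one>)"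
  using T
proof (induction k arbitrary: T)
  case 0
  then have "T = {}" by auto
  then show ?case by (simp add: generate_empty)
next
  case (Suc k)
  obtain x T' where x: "x \<in> carrier G" and T': "finite T'" "T' \<subseteq> carrier G" "card T' \<le> k"
    and gen: "generate G (insert x T') = generate G T"
    and indep: "\<And>i::int. x [^] i \<in> generate G T' \<Longrightarrow> x [^] i = \<one>"
    using cyclic_split[OF fin Suc.prems(1,2,3)] by metis
  obtain j :: "'a \<Rightarrow> int" and q
    where q: "\<And>u. u \<in> generate G T \<Longrightarrow> q u \<in> generate G T'"
    and dec: "\<And>u. u \<in> generate G T \<Longrightarrow> x [^] j u \<otimes> q u = u"
    and jm: "\<And>u v. u \<in> generate G T \<Longrightarrow> v \<in> generate G T \<Longrightarrow>
       x [^] j (u \<otimes> v) = x [^] j u \<otimes> x [^] j v"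
    and qm: "\<And>u v. u \<in> generate G T \<Longrightarrow> v \<in> generate G T \<Longrightarrow> q (u \<otimes> v) = q u \<otimes> q v"
    using cyclic_split_projections[OF x T'(2) indep] unfolding gen by metis
  obtain \<chi> where \<chi>: "\<And>i. i < k \<Longrightarrow> \<chi> i \<in> hom (G\<lparr>carrier := generate G T'\<rparr>) (integer_mod_group n)"
    and sep: "\<And>u. u \<in> generate G T' \<Longrightarrow> (\<forall>i<k. \<chi> i u = 0) \<Longrightarrow> u = \<one>"
    using Suc.IH[OF T'] by metis
  \<comment> \<open>Since \<open>n\<close> is \<open>c\<close> times the order of \<open>x\<close>,
    sending \<open>x [^] i\<close> to \<open>i * c\<close> modulo \<open>n\<close> is well defined
    and injective.\<close>
  define c where "c = n div ord x"
  have "ord x dvd n" using n x pow_eq_id by blast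
  then have c: "n = ord x * c" by (simp add: c_def)
  have c0: "0 < c" using n(1) c by (cases c) auto
  define \<psi> where "\<psi> = (\<lambda>u. (j u * int c) mod int n)"
  have \<psi>: "\<psi> \<in> hom (G\<lparr>carrier := generate G T\<rparr>) (integer_mod_group n)"
  proof (rule homI)
    fix u v assume "u \<in> carrier (G\<lparr>carrier := generate G T\<rparr>)" "v \<in> carrier (G\<lparr>carrier := generate G T\<rparr>)"
    then have uv: "u \<in> generate G T" "v \<in> generate G T" by auto
    \<comment> \<open>The exponents agree only modulo the order of \<open>x\<close>; the factor
      \<open>c\<close> turns this into a congruence modulo \<open>n\<close>.\<close>
    have "x [^] (j u + j v) = x [^] j (u \<otimes> v)" using x jm uv by (simp add: int_pow_mult)
    then have "int (ord x) dvd j (u \<otimes> v) - (j u + j v)" using x int_pow_eq by blast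
    then have "int n dvd (j (u \<otimes> v) - (j u + j v)) * int c"
      unfolding c of_nat_mult by (rule mult_dvd_mono) simp
    then have "int n dvd j (u \<otimes> v) * int c - (j u * int c + j v * int c)"
      by (simp add: algebra_simps)
    then have "(j (u \<otimes> v) * int c) mod int n = (j u * int c + j v * int c) mod int n"
      by (simp add: mod_eq_dvd_iff)
    then show "\<psi> (u \<otimes>\<^bsub>G\<lparr>carrier := generate G T\<rparr>\<^esub> v) = \<psi> u \<otimes>\<^bsub>integer_mod_group n\<^esub> \<psi> v"
      by (simp add: \<psi>_def mod_simps)
  qed (use n in \<open>auto simp: \<psi>_def carrier_integer_mod_group\<close>)
  show ?case
  \<comment> \<open>Indices below \<open>k\<close> carry the characters of the complementary factor,
    pulled back along \<open>q\<close>; the index \<open>k\<close> carries the new one.\<close>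
  proof (intro exI[of _ "\<lambda>i. if i < k then \<chi> i \<circ> q else \<psi>"] conjI allI impI ballI)
    fix i assume "i < Suc k"
    moreover have "\<chi> i \<circ> q \<in> hom (G\<lparr>carrier := generate G T\<rparr>) (integer_mod_group n)" if "i < k"
      using \<chi>[OF that] q qm by (auto simp: hom_def)
    ultimately show "(if i < k then \<chi> i \<circ> q else \<psi>) \<in> hom (G\<lparr>carrier := generate G T\<rparr>) (integer_mod_group n)"
      using \<psi> by simp
  next
    fix u assume u: "u \<in> generate G T" and z: "\<forall>i<Suc k. (if i < k then \<chi> i \<circ> q else \<psi>) u = 0"
    have 1: "q u = \<one>"
    proof (rule sep)
      show "\<forall>i<k. \<chi> i (q u) = 0"
      proof (intro allI impI)
        fix i assume "i < k"
        then show "\<chi> i (q u) = 0" using z[rule_format, of i] by simp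
      qed
    qed (use q u in auto)
    have "\<psi> u = 0" using z[rule_format, of k] by simp
    then have "int n dvd j u * int c" by (simp add: \<psi>_def dvd_eq_mod_eq_0)
    then have "int (ord x) dvd j u" using c0 by (simp add: c)
    then have "x [^] j u = \<one>" using x int_pow_eq_id by blast
    then show "u = \<one>" using dec[OF u] 1 by simp
  qed
qed

text \<open>With \<open>m\<close> the least positive exponent for which \<open>x [^] m\<close> lies
  in \<open>H\<close>, the new value \<open>t\<close> at \<open>x\<close> has to satisfy
  \<open>m * t = h (x [^] m)\<close>. This is solvable because \<open>m\<close> divides
  \<open>n\<close> and \<open>h\<close> vanishes on \<open>x [^] n\<close>.\<close>

lemma (in comm_group) character_extension_insert:
  assumes n: "0 < n" and sub: "subgroup H G" and x: "x \<in> carrier G" "x [^] n = \<one>"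
    and h: "h \<in> hom (G\<lparr>carrier := H\<rparr>) (integer_mod_group n)"
  obtains g where "g \<in> hom (G\<lparr>carrier := generate G (insert x H)\<rparr>) (integer_mod_group n)"
    "\<And>z. z \<in> H \<Longrightarrow> g z = h z"
proof -
  interpret H: subgroup H G by fact
  let ?GH = "G\<lparr>carrier := H\<rparr>"
  have GH: "group ?GH" using sub by (rule subgroup_imp_group)
  have hmult: "h (u \<otimes> v) = (h u + h v) mod int n" if "u \<in> H" "v \<in> H" for u v
    using h that by (auto simp: hom_def)
  have hc: "0 \<le> h u" "h u < int n" if "u \<in> H" for u
    using h that n by (auto simp: hom_def carrier_integer_mod_group)
  have hpow: "h (u [^] (k::int)) = (k * h u) mod int n" if "u \<in> H" for u k
    using hom_int_pow[OF h _ GH group_integer_mod_group, of u k] that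
    by (simp add: int_pow_integer_mod_group flip: int_pow_consistent[OF sub that])
  define m where "m = (LEAST m. 0 < m \<and> x [^] (m::nat) \<in> H)"
  have "\<exists>m. 0 < m \<and> x [^] (m::nat) \<in> H" using n x by (intro exI[of _ n]) simp
  then have "0 < m \<and> x [^] m \<in> H" unfolding m_def by (rule LeastI_ex)
  then have m: "0 < m" "x [^] m \<in> H" by auto
  \<comment> \<open>The exponents of the powers of \<open>x\<close> in \<open>H\<close> form an
    ideal of the integers, generated by \<open>m\<close>.\<close>
  have dvd: "int m dvd i" if i: "x [^] (i::int) \<in> H" for i
  proof -
    define r where "r = nat (i mod int m)"
    have r: "r < m" "int r = i - int m * (i div int m)"
      using m by (auto simp: r_def nat_less_iff minus_mult_div_eq_mod)
    have "x [^] int r = x [^] i \<otimes> inv ((x [^] int m) [^] (i div int m))"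
      using x by (simp add: r(2) int_pow_diff int_pow_pow)
    also have "\<dots> \<in> H"
      using i m subgroup_int_pow_closed[OF sub, of "x [^] int m"] by (auto simp: int_pow_int)
    finally have "r = 0" using not_less_Least[of r "\<lambda>m. 0 < m \<and> x [^] (m::nat) \<in> H"] r(1)
      by (auto simp: m_def int_pow_int)
    then show ?thesis using r(2) by (intro dvdI[of _ _ "i div int m"]) simp
  qed
  define k where "k = n div m"
  have "int m dvd int n" using dvd[of "int n"] x by (simp add: int_pow_int)
  then have k: "n = m * k" by (simp add: k_def)
  have k0: "0 < k" using n(1) unfolding k by simp
  \<comment> \<open>As \<open>x [^] n\<close> is trivial, \<open>n = m * k\<close> divides
    \<open>k * h (x [^] m)\<close>, and cancelling \<open>k\<close> leaves the divisor
    \<open>m\<close>. The quotient \<open>t\<close> is the value prescribed at \<open>x\<close>,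
    kept as an unreduced integer.\<close>
  have "(x [^] m) [^] int k = x [^] n" unfolding int_pow_int k by (rule nat_pow_pow[OF x(1)])
  then have "(int k * h (x [^] m)) mod int n = h \<one>" using hpow[OF m(2), of "int k"] x(2) by metis
  also have "h \<one> = 0" using hom_one[OF h GH] by simp
  finally have "int k * int m dvd int k * h (x [^] m)" unfolding k by (simp add: mod_eq_0_iff_dvd mult.commute)
  then have "int m dvd h (x [^] m)" using k0 by simp
  then obtain t where t: "h (x [^] m) = int m * t" by (elim dvdE)
  \<comment> \<open>Between two decompositions the exponent of \<open>x\<close> changes by a
    multiple of \<open>m\<close> and the factor in \<open>H\<close> by the compensating power of
    \<open>x [^] m\<close>; the contributions cancel because
    \<open>h (x [^] m) = m * t\<close>.\<close>
  have wd: "(h z + t * i) mod int n = (h z' + t * i') mod int n"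
    if "x [^] i \<otimes> z = x [^] i' \<otimes> z'" "z \<in> H" "z' \<in> H" for i i' :: int and z z'
  proof -
    have zz: "z \<in> carrier G" "z' \<in> carrier G" using that by auto
    have "x [^] (i - i') = inv (x [^] i') \<otimes> x [^] i"
      using x by (simp add: int_pow_diff m_comm)
    also have "\<dots> = inv (x [^] i') \<otimes> (x [^] i \<otimes> z) \<otimes> inv z"
      using x zz by (simp add: m_assoc)
    also have "\<dots> = z' \<otimes> inv z" using x zz by (simp add: that(1) flip: m_assoc)
    finally have eq: "x [^] (i - i') = z' \<otimes> inv z" .
    have "x [^] (i - i') \<in> H" unfolding eq using that by simp
    then obtain l where l: "i - i' = int m * l" using dvd dvdE by blast
    then have i: "i = i' + int m * l" by simp
    have "z' = x [^] (i - i') \<otimes> z" using eq zz by (simp add: m_assoc)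
    also have "x [^] (i - i') = (x [^] m) [^] l"
      unfolding l int_pow_pow[OF x(1), symmetric] by (simp only: int_pow_int)
    finally have z': "z' = (x [^] m) [^] l \<otimes> z" .
    have "h z' = (l * (int m * t) + h z) mod int n"
      unfolding z' using m(2) that(2) subgroup_int_pow_closed[OF sub m(2)] by (simp add: hmult hpow t mod_simps)
    then have "(h z' + t * i') mod int n = (l * (int m * t) + h z + t * i') mod int n"
      by (simp add: mod_simps)
    also have "l * (int m * t) + h z + t * i' = h z + t * i" by (simp add: i algebra_simps)
    finally show ?thesis by simp
  qed
  have gH: "generate G H = H" using sub generate_subgroup_incl[OF order_refl] by (auto intro: generate.incl)
  have mem: "u \<in> generate G (insert x H) \<longleftrightarrow> (\<exists>i::int. \<exists>z\<in>H. u = x [^] i \<otimes> z)" for u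
    using mem_generate_insert[OF x(1) H.subset] by (simp add: gH)
  then have "\<forall>u\<in>generate G (insert x H). \<exists>p. snd p \<in> H \<and> u = x [^] (fst p :: int) \<otimes> snd p"
    by fastforce
  then obtain p where p: "\<And>u. u \<in> generate G (insert x H) \<Longrightarrow> snd (p u) \<in> H \<and> u = x [^] (fst (p u) :: int) \<otimes> snd (p u)"
    by metis
  define g where "g = (\<lambda>u. (h (snd (p u)) + t * fst (p u)) mod int n)"
  have g: "g (x [^] i \<otimes> z) = (h z + t * i) mod int n" if "z \<in> H" for i :: int and z
  proof -
    have "x [^] i \<otimes> z \<in> generate G (insert x H)" using mem that by blast
    from p[OF this] show ?thesis unfolding g_def using that by (intro wd) auto
  qed
  show thesis
  proof
    show "g \<in> hom (G\<lparr>carrier := generate G (insert x H)\<rparr>) (integer_mod_group n)"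
    proof (rule homI)
      fix u v assume "u \<in> carrier (G\<lparr>carrier := generate G (insert x H)\<rparr>)"
        "v \<in> carrier (G\<lparr>carrier := generate G (insert x H)\<rparr>)"
      then obtain i i' :: int and z z'
        where uv: "u = x [^] i \<otimes> z" "v = x [^] i' \<otimes> z'" "z \<in> H" "z' \<in> H"
        by (auto simp: mem)
      then have "u \<otimes> v = x [^] (i + i') \<otimes> (z \<otimes> z')" using x by (simp add: int_pow_mult m_ac)
      then show "g (u \<otimes>\<^bsub>G\<lparr>carrier := generate G (insert x H)\<rparr>\<^esub> v) = g u \<otimes>\<^bsub>integer_mod_group n\<^esub> g v"
        using uv by (simp add: g hmult mod_simps) (simp add: algebra_simps)
    qed (use n in \<open>auto simp: g_def carrier_integer_mod_group\<close>)
    fix z assume "z \<in> H"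
    then show "g z = h z" using g[of z 0] hc by simp
  qed
qed

text \<open>Elements are adjoined to \<open>H\<close> one at a time, which strictly decreases the
  number of elements outside. This is the injectivity of the integers modulo \<open>n\<close> among
  finite abelian groups of exponent dividing \<open>n\<close>.\<close>

lemma (in comm_group) character_extension:
  assumes fin: "finite (carrier G)" and n: "0 < n" "\<And>x. x \<in> carrier G \<Longrightarrow> x [^] n = \<one>"
    and "subgroup H G" "h \<in> hom (G\<lparr>carrier := H\<rparr>) (integer_mod_group n)"
  shows "\<exists>g\<in>hom G (integer_mod_group n). \<forall>z\<in>H. g z = h z"
  using assms(4,5)
proof (induction "card (carrier G - H)" arbitrary: H h rule: less_induct)
  case less
  have HG: "H \<subseteq> carrier G" using less.prems(1) by (rule subgroup.subset)
  show ?case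
  proof (cases "H = carrier G")
    case True
    then show ?thesis using less.prems by (auto simp: hom_def)
  next
    case False
    then obtain x where x: "x \<in> carrier G" "x \<notin> H" using HG by blast
    let ?K = "generate G (insert x H)"
    obtain g where g: "g \<in> hom (G\<lparr>carrier := ?K\<rparr>) (integer_mod_group n)" "\<And>z. z \<in> H \<Longrightarrow> g z = h z"
      using character_extension_insert[OF n(1) less.prems(1) x(1) n(2)[OF x(1)] less.prems(2)] by metis
    have K: "subgroup ?K G" using x HG by (intro generate_is_subgroup) auto
    have "H \<subseteq> ?K" "x \<in> ?K" by (auto intro: generate.incl)
    then have "carrier G - ?K \<subset> carrier G - H" using x by blast
    then have "card (carrier G - ?K) < card (carrier G - H)" using fin by (intro psubset_card_mono) auto
    from less.hyps[OF this K g(1)] show ?thesis using g(2) \<open>H \<subseteq> ?K\<close> by (metis subsetD)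
  qed
qed

section \<open>Exponents and generating ranks\<close>

text \<open>Turns each divisibility between exponents into an identity for powers.\<close>

lemma (in group) group_exponent_dvd_iff:
  "group_exponent G dvd k \<longleftrightarrow> (\<forall>x\<in>carrier G. x [^] k = \<one>)"
proof (cases "\<exists>n>0. \<forall>x\<in>carrier G. x [^] (n::nat) = \<one>")
  case True
  define e where "e = group_exponent G"
  have e_def': "e = (LEAST n. n > 0 \<and> (\<forall>x\<in>carrier G. x [^] n = \<one>))"
    using True by (simp add: e_def group_exponent_def)
  have "e > 0 \<and> (\<forall>x\<in>carrier G. x [^] e = \<one>)"
    unfolding e_def' using True by (rule LeastI_ex)
  then have e: "e > 0" "\<And>x. x \<in> carrier G \<Longrightarrow> x [^] e = \<one>" by auto
  have pow_mod: "x [^] k = x [^] (k mod e)" if "x \<in> carrier G" for x k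
  proof -
    have "x [^] k = x [^] (e * (k div e) + k mod e)" by simp
    also have "\<dots> = x [^] (k mod e)"
      using that by (simp only: nat_pow_mult[symmetric] nat_pow_pow[symmetric] e nat_pow_one) simp
    finally show ?thesis .
  qed
  show ?thesis
  proof
    assume "group_exponent G dvd k"
    then have "k mod e = 0" by (simp add: e_def)
    then show "\<forall>x\<in>carrier G. x [^] k = \<one>" using pow_mod[of _ k] by simp
  next
    assume *: "\<forall>x\<in>carrier G. x [^] k = \<one>"
    have "\<forall>x\<in>carrier G. x [^] (k mod e) = \<one>"
    proof
      fix x assume "x \<in> carrier G"
      then show "x [^] (k mod e) = \<one>" using * pow_mod[of x k] by metis
    qed
    moreover have "k mod e < e" using e by simp
    ultimately have "k mod e = 0" using not_less_Least[of "k mod e" "\<lambda>n. n > 0 \<and> (\<forall>x\<in>carrier G. x [^] n = \<one>)"]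
      unfolding e_def'[symmetric] by auto
    then show "group_exponent G dvd k" by (simp add: e_def[symmetric] dvd_eq_mod_eq_0)
  qed
next
  case False
  \<comment> \<open>Without a positive exponent both sides say \<open>k = 0\<close>, in accordance
    with the value \<open>0\<close> for infinite exponent.\<close>
  then have "group_exponent G = 0" unfolding group_exponent_def by (rule if_not_P)
  then show ?thesis using False by auto
qed

lemma gen_rank_le:
  assumes "finite S" "S \<subseteq> carrier G" "generate G S = carrier G"
  shows "gen_rank G \<le> enat (card S)"
  unfolding gen_rank_def using assms by (intro INF_lower2[of S]) auto

lemma gen_rank_geI:
  assumes "\<And>S. finite S \<Longrightarrow> S \<subseteq> carrier G \<Longrightarrow> generate G S = carrier G \<Longrightarrow> r \<le> enat (card S)"
  shows "r \<le> gen_rank G"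
  unfolding gen_rank_def using assms by (intro INF_greatest) auto

text \<open>A nonempty set of extended naturals contains its infimum, and every generating set of a
  finite group is finite.\<close>

lemma (in group) gen_rank_attained:
  assumes "finite (carrier G)"
  obtains S where "finite S" "S \<subseteq> carrier G" "generate G S = carrier G" "gen_rank G = enat (card S)"
proof -
  let ?F = "\<lambda>S. if finite S then enat (card S) else \<infinity>"
  let ?A = "{S. S \<subseteq> carrier G \<and> generate G S = carrier G}"
  have "carrier G \<in> ?A"
    using generate_incl[OF order_refl] by (auto intro: generate.incl)
  then have "?F ` ?A \<noteq> {}" by blast
  then have "\<exists>r. r \<in> ?F ` ?A" by blast
  then have "Inf (?F ` ?A) \<in> ?F ` ?A" using \<open>?F ` ?A \<noteq> {}\<close>
    unfolding Inf_enat_def by (simp only: if_False) (rule LeastI_ex)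
  then obtain S where "S \<in> ?A" "gen_rank G = ?F S" unfolding gen_rank_def by blast
  then show thesis using that[of S] finite_subset[OF _ assms, of S] by auto
qed

text \<open>The image of a generating set generates the image and has at most as many
  elements.\<close>

lemma gen_rank_epi:
  assumes "group G" "group H" "f \<in> hom G H" "f ` carrier G = carrier H"
  shows "gen_rank H \<le> gen_rank G"
proof (rule gen_rank_geI)
  fix S assume S: "finite S" "S \<subseteq> carrier G" "generate G S = carrier G"
  interpret group_hom G H f by (intro group_hom.intro group_hom_axioms.intro assms)
  have "gen_rank H \<le> enat (card (f ` S))"
    using S assms generate_img[OF S(2)] by (intro gen_rank_le) auto
  also have "\<dots> \<le> enat (card S)" using S by (simp add: card_image_le)
  finally show "gen_rank H \<le> enat (card S)" .
qed

text \<open>The abelian groups of the theorem have elements of type \<open>nat\<close>, so the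
  cosets of \<open>N\<close> are numbered injectively. Only the projection and its kernel are passed
  on.\<close>

lemma (in group) nat_quotient:
  assumes N: "N \<lhd> G" and fin: "finite (carrier G)"
  obtains A :: "nat monoid" and f where "group A" "f \<in> hom G A" "f ` carrier G = carrier A"
    "\<And>x. x \<in> carrier G \<Longrightarrow> f x = \<one>\<^bsub>A\<^esub> \<longleftrightarrow> x \<in> N"
proof -
  interpret N: normal N G by fact
  have "finite (rcosets N)" using fin by (simp add: RCOSETS_def)
  then obtain e :: "'a set \<Rightarrow> nat" and k where e: "inj_on e (rcosets N)"
    using finite_imp_inj_to_nat_seg by metis
  define f where "f = (\<lambda>x. e (N #> x))"
  have f: "f a = f b \<longleftrightarrow> a \<otimes> inv b \<in> N" if "a \<in> carrier G" "b \<in> carrier G" for a b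
  proof -
    have "f a = f b \<longleftrightarrow> N #> b = N #> a"
      using e that by (auto simp: f_def RCOSETS_def inj_on_def)
    also have "\<dots> \<longleftrightarrow> a \<in> N #> b"
      using that rcos_self[OF that(1) N.subgroup_axioms] repr_independence[OF _ that(2) N.subgroup_axioms] by metis
    also have "\<dots> \<longleftrightarrow> a \<otimes> inv b \<in> N"
      using that N.rcos_module[OF is_group] by simp
    finally show ?thesis .
  qed
  then have weak: "weak_group_morphism f N G" by (intro weak_group_morphismsI N)
  have "f x = f \<one> \<longleftrightarrow> x \<in> N" if "x \<in> carrier G" for x using f[OF that one_closed] that by simp
  then show thesis
    using that[OF image_group_is_group[OF weak] weak_group_morphism_is_hom[OF weak]]
    by (simp add: image_group_carrier image_group_one)
qed

text \<open>Each generator contributes at most \<open>n\<close> different powers. The count yields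
  the lower bound for the rank of a homocyclic group.\<close>

lemma (in comm_group) card_generate_le:
  assumes n: "0 < n" "\<And>x. x \<in> carrier G \<Longrightarrow> x [^] n = \<one>" and S: "finite S" "S \<subseteq> carrier G"
  shows "finite (generate G S) \<and> card (generate G S) \<le> n ^ card S"
  using S
proof (induction S)
  case empty
  then show ?case by (simp add: generate_empty)
next
  case (insert x S)
  then have IH: "finite (generate G S)" "card (generate G S) \<le> n ^ card S" by auto
  have x: "x \<in> carrier G" "S \<subseteq> carrier G" using insert by auto
  let ?P = "{..<n} \<times> generate G S"
  have "generate G (insert x S) \<subseteq> (\<lambda>(i, w). x [^] i \<otimes> w) ` ?P"
  proof
    fix y assume "y \<in> generate G (insert x S)"
    then obtain i :: int and w where w: "w \<in> generate G S" "y = x [^] i \<otimes> w"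
      using mem_generate_insert[OF x] by blast
    define r where "r = nat (i mod int n)"
    have r: "r < n" "int r = i mod int n" using n by (auto simp: r_def nat_less_iff)
    have "int (ord x) dvd int n" using x n pow_eq_id by auto
    then have "int (ord x) dvd int r - i" unfolding r
      by (metis dvd_minus_mod dvd_trans dvd_minus_iff minus_diff_eq)
    then have "x [^] i = x [^] r" using x int_pow_eq by (metis int_pow_int)
    then show "y \<in> (\<lambda>(i, w). x [^] i \<otimes> w) ` ?P" using w r
      by (intro image_eqI[of _ _ "(r, w)"]) auto
  qed
  moreover have P: "finite ?P" using IH by simp
  ultimately have "finite (generate G (insert x S))" "card (generate G (insert x S)) \<le> card ?P"
    by (auto intro: finite_surj surj_card_le)
  moreover have "card ?P \<le> n ^ card (insert x S)" using IH insert by (simp add: mult_mono)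
  ultimately show ?case by linarith
qed

section \<open>Homocyclic groups\<close>

context
  fixes n d :: nat and P
  assumes n: "0 < n"
  defines "P \<equiv> product_group {..<d} (\<lambda>_. integer_mod_group n)"
begin

lemma homocyclic_comm_group: "comm_group P"
proof (rule group.group_comm_groupI)
  show "group P" by (simp add: P_def)
  fix x y
  show "x \<otimes>\<^bsub>P\<^esub> y = y \<otimes>\<^bsub>P\<^esub> x" by (simp add: P_def add.commute)
qed

lemma homocyclic_pow:
  assumes "x \<in> carrier P"
  shows "x [^]\<^bsub>P\<^esub> (m::nat) = (\<lambda>i\<in>{..<d}. (int m * x i) mod int n)"
proof (induction m)
  case (Suc m)
  then show ?case by (auto simp: P_def algebra_simps mod_simps fun_eq_iff)
qed (auto simp: P_def)

lemma homocyclic_exponent: "x \<in> carrier P \<Longrightarrow> x [^]\<^bsub>P\<^esub> n = \<one>\<^bsub>P\<^esub>"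
  unfolding homocyclic_pow by (simp add: P_def)

lemma homocyclic_card: "finite (carrier P)" "card (carrier P) = n ^ d"
  using n by (simp_all add: P_def carrier_integer_mod_group card_PiE finite_PiE)

text \<open>Induction on the number of leading coordinates that may be nonzero. For
  \<open>n = 1\<close> all unit vectors coincide, hence \<open>card S \<le> d\<close> instead of an
  equality.\<close>

lemma homocyclic_unit_vectors_generate:
  obtains S where "finite S" "S \<subseteq> carrier P" "card S \<le> d" "generate P S = carrier P"
proof -
  interpret comm_group P by (rule homocyclic_comm_group)
  \<comment> \<open>The \<open>m\<close>-fold multiple of the \<open>i\<close>-th unit vector;
    reduction modulo \<open>n\<close> keeps it in the carrier also for \<open>n = 1\<close>.\<close>
  define v where "v = (\<lambda>i (m::int). \<lambda>k\<in>{..<d}. if k = i then m mod int n else 0)"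
  let ?S = "(\<lambda>i. v i 1) ` {..<d}"
  have S: "?S \<subseteq> carrier P"
    using n by (auto simp: v_def P_def carrier_integer_mod_group)
  have v: "v i (int m) \<in> generate P ?S" if "i < d" for i m
  proof (induction m)
    case 0
    have "v i (int 0) = \<one>\<^bsub>P\<^esub>" by (auto simp: v_def P_def)
    then show ?case by (simp only: generate.one)
  next
    case (Suc m)
    have "v i (int (Suc m)) = v i (int m) \<otimes>\<^bsub>P\<^esub> v i 1"
      by (auto simp: v_def P_def fun_eq_iff mod_simps add.commute)
    moreover have "v i 1 \<in> generate P ?S" using that by (intro generate.incl) auto
    ultimately show ?case using generate.eng[OF Suc.IH] by (simp only:)
  qed
  have range: "0 \<le> f k" "f k < int n" if "f \<in> carrier P" "k < d" for f k
    using PiE_mem[of f "{..<d}" "\<lambda>_. carrier (integer_mod_group n)" k] that n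
    by (simp_all add: P_def carrier_integer_mod_group)
  have undef: "f k = undefined" if "f \<in> carrier P" "\<not> k < d" for f k
    using that PiE_arb[of f "{..<d}" _ k] by (simp add: P_def)
  have *: "\<forall>f\<in>carrier P. (\<forall>k. j \<le> k \<longrightarrow> k < d \<longrightarrow> f k = 0) \<longrightarrow> f \<in> generate P ?S" if "j \<le> d" for j
    using that
  proof (induction j)
    case 0
    show ?case
    proof (intro ballI impI)
      fix f assume f: "f \<in> carrier P" "\<forall>k. 0 \<le> k \<longrightarrow> k < d \<longrightarrow> f k = 0"
      have "f = \<one>\<^bsub>P\<^esub>"
      proof
        fix k show "f k = \<one>\<^bsub>P\<^esub> k" using f undef[of f k] by (cases "k < d") (simp_all add: P_def)
      qed
      then show "f \<in> generate P ?S" by (simp only: generate.one)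
    qed
  next
    case (Suc j)
    show ?case
    proof (intro ballI impI)
      fix f assume f: "f \<in> carrier P" "\<forall>k. Suc j \<le> k \<longrightarrow> k < d \<longrightarrow> f k = 0"
      \<comment> \<open>Clearing the last admissible coordinate makes the induction hypothesis
        applicable; a multiple of a unit vector restores it.\<close>
      define g where "g = (\<lambda>k\<in>{..<d}. if k = j then 0 else f k)"
      have "g \<in> carrier P"
        using n range[OF f(1)] by (auto simp: g_def P_def carrier_integer_mod_group)
      moreover have "\<forall>k. j \<le> k \<longrightarrow> k < d \<longrightarrow> g k = 0"
        using f(2) by (auto simp: g_def)
      ultimately have g: "g \<in> generate P ?S" using Suc by simp
      have "f = g \<otimes>\<^bsub>P\<^esub> v j (int (nat (f j)))"
      proof
        fix k show "f k = (g \<otimes>\<^bsub>P\<^esub> v j (int (nat (f j)))) k"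
          using range[OF f(1), of k] undef[OF f(1), of k] by (cases "k < d") (auto simp: P_def g_def v_def)
      qed
      then show "f \<in> generate P ?S"
        using generate.eng[OF g v[of j "nat (f j)"]] Suc.prems by simp
    qed
  qed
  have "generate P ?S = carrier P"
    using *[OF order_refl] generate_incl[OF S] by auto
  moreover have "card ?S \<le> d" using card_image_le[of "{..<d}" "\<lambda>i. v i 1"] by simp
  ultimately show thesis using that[of ?S] S by blast
qed

text \<open>The unit vectors give the upper bound. For the lower one, a set \<open>S\<close>
  generates at most \<open>n ^ card S\<close> of the \<open>n ^ d\<close> elements. The assumption
  excludes the trivial group written with \<open>n = 1\<close> and positive
  \<open>d\<close>.\<close>

lemma homocyclic_gen_rank:
  assumes "1 < n \<or> d = 0" shows "gen_rank P = enat d"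
proof (rule antisym)
  interpret comm_group P by (rule homocyclic_comm_group)
  obtain S where S: "finite S" "S \<subseteq> carrier P" "card S \<le> d" "generate P S = carrier P"
    by (rule homocyclic_unit_vectors_generate)
  have "gen_rank P \<le> enat (card S)" using S by (intro gen_rank_le)
  also have "\<dots> \<le> enat d" using S by simp
  finally show "gen_rank P \<le> enat d" .
  show "enat d \<le> gen_rank P"
  proof (rule gen_rank_geI)
    fix S assume S: "finite S" "S \<subseteq> carrier P" "generate P S = carrier P"
    have "n ^ d \<le> n ^ card S"
      using card_generate_le[OF n homocyclic_exponent S(1,2)] S(3) homocyclic_card by simp
    then show "enat d \<le> enat (card S)" using assms by auto
  qed
qed

lemma homocyclic_hom:
  assumes "\<And>i. i < d \<Longrightarrow> \<chi> i \<in> hom E (integer_mod_group n)"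
  shows "(\<lambda>x. \<lambda>i\<in>{..<d}. \<chi> i x) \<in> hom E P"
proof (rule homI)
  fix x y assume "x \<in> carrier E" "y \<in> carrier E"
  then show "(\<lambda>i\<in>{..<d}. \<chi> i (x \<otimes>\<^bsub>E\<^esub> y)) = (\<lambda>i\<in>{..<d}. \<chi> i x) \<otimes>\<^bsub>P\<^esub> (\<lambda>i\<in>{..<d}. \<chi> i y)"
    using hom_mult[OF assms] by (intro ext) (simp add: P_def)
next
  fix x assume "x \<in> carrier E"
  then show "(\<lambda>i\<in>{..<d}. \<chi> i x) \<in> carrier P"
    using hom_in_carrier[OF assms] by (simp add: P_def)
qed

end

section \<open>Groups of class two\<close>

locale class2_group = group G for G (structure) +
  assumes commutator_in_center:
    "x \<in> carrier G \<Longrightarrow> y \<in> carrier G \<Longrightarrow> x \<otimes> y \<otimes> inv x \<otimes> inv y \<in> center G"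
begin

definition commutator where "commutator x y = x \<otimes> y \<otimes> inv x \<otimes> inv y"

lemma centerD: "z \<in> center G \<Longrightarrow> z \<in> carrier G"
  "z \<in> center G \<Longrightarrow> x \<in> carrier G \<Longrightarrow> z \<otimes> x = x \<otimes> z"
  by (auto simp: center_def)

text \<open>In the right-bracketed form produced by \<open>m_assoc\<close>, this moves a central
  factor to the front.\<close>

lemma center_lcomm:
  assumes "z \<in> center G" "x \<in> carrier G" "y \<in> carrier G"
  shows "x \<otimes> (z \<otimes> y) = z \<otimes> (x \<otimes> y)"
  using assms centerD(1)[OF assms(1)] centerD(2)[OF assms(1,2)] by (simp flip: m_assoc)

lemma subgroup_center: "subgroup (center G) G"
proof (rule subgroupI)
  fix a assume a: "a \<in> center G"
  note ac = centerD(1)[OF a]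
  have "inv a \<otimes> x = x \<otimes> inv a" if x: "x \<in> carrier G" for x
  proof -
    have "inv a \<otimes> x = inv a \<otimes> (x \<otimes> a) \<otimes> inv a" using ac x by (simp add: m_assoc)
    also have "\<dots> = inv a \<otimes> (a \<otimes> x) \<otimes> inv a" using centerD(2)[OF a x] by simp
    also have "\<dots> = x \<otimes> inv a" using ac x by (simp flip: m_assoc)
    finally show ?thesis .
  qed
  then show "inv a \<in> center G" using ac by (simp add: center_def)
  fix b assume b: "b \<in> center G"
  note bc = centerD(1)[OF b]
  have "a \<otimes> b \<otimes> x = x \<otimes> (a \<otimes> b)" if x: "x \<in> carrier G" for x
    using ac bc x center_lcomm[OF a x bc] centerD(2)[OF b x] by (simp add: m_assoc)
  then show "a \<otimes> b \<in> center G" using ac bc by (simp add: center_def)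
next
  show "center G \<subseteq> carrier G" by (auto simp: center_def)
  have "\<one> \<in> center G" by (simp add: center_def)
  then show "center G \<noteq> {}" by blast
qed

lemma normal_center: "center G \<lhd> G"
proof (rule normal_invI[OF subgroup_center])
  fix x h assume "x \<in> carrier G" "h \<in> center G"
  then have "x \<otimes> h \<otimes> inv x = h"
    using centerD(1)[of h] centerD(2)[of h x, symmetric] by (simp add: m_assoc)
  then show "x \<otimes> h \<otimes> inv x \<in> center G" using \<open>h \<in> center G\<close> by simp
qed

lemma commutator_center [simp]:
  "x \<in> carrier G \<Longrightarrow> y \<in> carrier G \<Longrightarrow> commutator x y \<in> center G"
  by (simp add: commutator_def commutator_in_center)

lemma commutator_closed [simp]:
  "x \<in> carrier G \<Longrightarrow> y \<in> carrier G \<Longrightarrow> commutator x y \<in> carrier G"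
  using centerD(1) by simp

lemma commutator_swap:
  assumes "x \<in> carrier G" "y \<in> carrier G" shows "x \<otimes> y = commutator x y \<otimes> (y \<otimes> x)"
proof -
  have "commutator x y \<otimes> (y \<otimes> x) = x \<otimes> y \<otimes> inv x \<otimes> (inv y \<otimes> y) \<otimes> x"
    unfolding commutator_def using assms by (simp only: m_assoc m_closed inv_closed)
  also have "\<dots> = x \<otimes> y" using assms by (simp add: m_assoc)
  finally show ?thesis by simp
qed

lemma commutator_eqI:
  assumes "x \<in> carrier G" "y \<in> carrier G" "c \<in> carrier G" "x \<otimes> y = c \<otimes> (y \<otimes> x)"
  shows "commutator x y = c"
  using assms commutator_swap[OF assms(1,2)] right_cancel[of "y \<otimes> x" "commutator x y" c] by simp

text \<open>Moving \<open>y\<close> to the left past \<open>x'\<close> and then past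
  \<open>x\<close> releases one central factor each time.\<close>

lemma commutator_mult_left:
  assumes "x \<in> carrier G" "x' \<in> carrier G" "y \<in> carrier G"
  shows "commutator (x \<otimes> x') y = commutator x y \<otimes> commutator x' y"
proof (rule commutator_eqI)
  have "x \<otimes> x' \<otimes> y = x \<otimes> (commutator x' y \<otimes> (y \<otimes> x'))"
    using assms commutator_swap[of x' y] by (simp add: m_assoc)
  also have "\<dots> = commutator x' y \<otimes> ((x \<otimes> y) \<otimes> x')"
    using assms center_lcomm[of "commutator x' y" x "y \<otimes> x'"] by (simp add: m_assoc)
  also have "\<dots> = commutator x' y \<otimes> (commutator x y \<otimes> (y \<otimes> x) \<otimes> x')"
    using assms commutator_swap[of x y] by simp
  also have "\<dots> = commutator x y \<otimes> commutator x' y \<otimes> (y \<otimes> (x \<otimes> x'))"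
    using assms center_lcomm[of "commutator x y" "commutator x' y" "y \<otimes> (x \<otimes> x')"]
    by (simp add: m_assoc)
  finally show "x \<otimes> x' \<otimes> y = commutator x y \<otimes> commutator x' y \<otimes> (y \<otimes> (x \<otimes> x'))" .
qed (use assms in auto)

lemma commutator_inverse:
  assumes "x \<in> carrier G" "y \<in> carrier G"
  shows "commutator x y = inv (commutator y x)"
  using assms by (simp add: commutator_def inv_mult_group m_assoc)

text \<open>Exchanging the arguments inverts a commutator and reduces the claim to the first
  argument.\<close>

lemma commutator_mult_right:
  assumes "x \<in> carrier G" "y \<in> carrier G" "y' \<in> carrier G"
  shows "commutator x (y \<otimes> y') = commutator x y \<otimes> commutator x y'"
proof -
  have "commutator x (y \<otimes> y') = inv (commutator y x \<otimes> commutator y' x)"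
    using assms commutator_inverse[of x "y \<otimes> y'"] by (simp add: commutator_mult_left)
  also have "\<dots> = inv (commutator y' x \<otimes> commutator y x)"
    using assms centerD(2)[of "commutator y x" "commutator y' x"] by simp
  also have "\<dots> = commutator x y \<otimes> commutator x y'"
    using assms commutator_inverse[of x] by (simp add: inv_mult_group)
  finally show ?thesis .
qed

lemma commutator_self: "x \<in> carrier G \<Longrightarrow> commutator x x = \<one>"
  by (simp add: commutator_eqI)

lemma commutator_of_center: "z \<in> center G \<Longrightarrow> x \<in> carrier G \<Longrightarrow> commutator z x = \<one>"
  using centerD by (simp add: commutator_eqI)

lemma commutator_eq_one_imp_center:
  assumes "x \<in> carrier G" "\<And>y. y \<in> carrier G \<Longrightarrow> commutator x y = \<one>"
  shows "x \<in> center G"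
  using assms commutator_swap[OF assms(1)] by (simp add: center_def)

lemma commutator_in_derived:
  "x \<in> carrier G \<Longrightarrow> y \<in> carrier G \<Longrightarrow> commutator x y \<in> derived G (carrier G)"
  unfolding derived_def commutator_def by (intro generate.incl) auto

lemma subgroup_derived: "subgroup (derived G (carrier G)) G"
  by (rule derived_is_subgroup) simp

lemma derived_subset_subgroup:
  assumes "subgroup H G" "\<And>x y. x \<in> carrier G \<Longrightarrow> y \<in> carrier G \<Longrightarrow> commutator x y \<in> H"
  shows "derived G (carrier G) \<subseteq> H"
  unfolding derived_def using assms by (intro generate_subgroup_incl) (auto simp: commutator_def)

lemma derived_subset_center: "derived G (carrier G) \<subseteq> center G"
  using subgroup_center by (rule derived_subset_subgroup) simp

lemma comm_group_restrict_center:
  assumes "subgroup H G" "H \<subseteq> center G" shows "comm_group (G\<lparr>carrier := H\<rparr>)"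
proof (rule group.group_comm_groupI)
  show "group (G\<lparr>carrier := H\<rparr>)" using assms by (simp add: subgroup_imp_group)
next
  fix x y assume "x \<in> carrier (G\<lparr>carrier := H\<rparr>)" "y \<in> carrier (G\<lparr>carrier := H\<rparr>)"
  then have "x \<in> center G" "y \<in> carrier G" using assms(2) centerD(1) by auto
  then show "x \<otimes>\<^bsub>G\<lparr>carrier := H\<rparr>\<^esub> y = y \<otimes>\<^bsub>G\<lparr>carrier := H\<rparr>\<^esub> x" using centerD(2) by simp
qed

text \<open>Moving a new factor \<open>x\<close> to the left past \<open>y [^] k\<close> releases
  the \<open>k\<close>-th power of \<open>commutator y x\<close>. The exponent is
  \<open>k * (k - 1) div 2\<close>, written as a sum so that the induction step adds one
  summand.\<close>

lemma power_mult_class2: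
  assumes "x \<in> carrier G" "y \<in> carrier G"
  shows "(x \<otimes> y) [^] (k::nat) = commutator y x [^] (\<Sum>{..<k}) \<otimes> (x [^] k \<otimes> y [^] k)"
proof (induction k)
  case 0
  then show ?case by simp
next
  case (Suc k)
  have "commutator \<one> x = \<one>" by (rule commutator_eqI) (use assms in simp_all)
  then have pow: "commutator (y [^] k) x = commutator y x [^] k" for k :: nat
    by (induction k) (use assms in \<open>simp_all add: commutator_mult_left\<close>)
  have c: "commutator y x [^] (i::nat) \<in> center G" for i
    using assms subgroup_int_pow_closed[OF subgroup_center, of "commutator y x" "int i"] by (simp add: int_pow_int)
  have "(x \<otimes> y) [^] Suc k = commutator y x [^] (\<Sum>{..<k}) \<otimes> (x [^] k \<otimes> ((y [^] k \<otimes> x) \<otimes> y))"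
    using assms by (simp add: Suc m_assoc)
  also have "y [^] k \<otimes> x = commutator y x [^] k \<otimes> (x \<otimes> y [^] k)"
    using assms commutator_swap[of "y [^] k" x] by (simp add: pow)
  also have "commutator y x [^] (\<Sum>{..<k}) \<otimes> (x [^] k \<otimes> (commutator y x [^] k \<otimes> (x \<otimes> y [^] k) \<otimes> y)) =
      (commutator y x [^] (\<Sum>{..<k}) \<otimes> commutator y x [^] k) \<otimes> (x [^] k \<otimes> x \<otimes> (y [^] k \<otimes> y))"
    using assms center_lcomm[OF c[of k], of "x [^] k" "x \<otimes> (y [^] k \<otimes> y)"] by (simp add: m_assoc)
  also have "\<dots> = commutator y x [^] (\<Sum>{..<Suc k}) \<otimes> (x [^] Suc k \<otimes> y [^] Suc k)"
    using assms by (simp add: nat_pow_mult)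
  finally show ?case .
qed

text \<open>When all \<open>n\<close>-th powers are trivial, expanding the \<open>n\<close>-th power
  of a product leaves only the power of the commutator. Taking \<open>H\<close> inside the centre
  makes powers multiplicative on it, so the identity passes from commutators to the subgroup they
  generate.\<close>

lemma derived_triangular_power:
  assumes n: "\<And>x. x \<in> carrier G \<Longrightarrow> x [^] (n::nat) = \<one>" and d: "d \<in> derived G (carrier G)"
  shows "d [^] (\<Sum>{..<n}) = \<one>"
proof -
  define H where "H = {z \<in> center G. z [^] (\<Sum>{..<n}) = \<one>}"
  have "subgroup H G"
  proof (rule subgroupI)
    fix a b assume ab: "a \<in> H" "b \<in> H"
    then have c: "a \<in> center G" "b \<in> center G" "a [^] (\<Sum>{..<n}) = \<one>" "b [^] (\<Sum>{..<n}) = \<one>"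
      by (auto simp: H_def)
    show "a \<otimes> b \<in> H"
      using c centerD subgroup.m_closed[OF subgroup_center] by (simp add: H_def pow_mult_distrib)
    show "inv a \<in> H"
      using c centerD subgroup.m_inv_closed[OF subgroup_center] by (simp add: H_def nat_pow_inv)
  qed (auto simp: H_def center_def)
  moreover have "commutator x y \<in> H" if "x \<in> carrier G" "y \<in> carrier G" for x y
    using power_mult_class2[OF that(2,1), of n] n that by (simp add: H_def)
  ultimately have "d \<in> H" using d derived_subset_subgroup[of H] by blast
  then show ?thesis by (simp add: H_def)
qed

lemma comm_group_Mod_center: "comm_group (G Mod center G)"
proof (rule group.group_comm_groupI)
  interpret Z: normal "center G" G by (rule normal_center)
  show "group (G Mod center G)" by (rule Z.factorgroup_is_group)
  fix U W assume "U \<in> carrier (G Mod center G)" "W \<in> carrier (G Mod center G)"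
  then obtain x y where xy: "x \<in> carrier G" "y \<in> carrier G" "U = center G #> x" "W = center G #> y"
    by (auto simp: carrier_FactGroup)
  have "center G #> (x \<otimes> y) = center G #> (commutator x y \<otimes> (y \<otimes> x))"
    using xy commutator_swap by metis
  also have "\<dots> = (center G #> commutator x y) #> (y \<otimes> x)"
    using xy Z.subset by (simp add: coset_mult_assoc)
  also have "center G #> commutator x y = center G"
    using xy by (intro coset_join2 subgroup_center) auto
  finally show "U \<otimes>\<^bsub>G Mod center G\<^esub> W = W \<otimes>\<^bsub>G Mod center G\<^esub> U"
    using xy by (simp add: Z.rcos_sum)
qed

lemma commutator_coset_cong:
  assumes "center G #> x = center G #> x'" "x \<in> carrier G" "x' \<in> carrier G" "y \<in> carrier G"
  shows "commutator x y = commutator x' y"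
proof -
  have "x \<in> center G #> x'" using assms rcos_self[OF assms(2) subgroup_center] by simp
  then obtain z where "z \<in> center G" "x = z \<otimes> x'" by (auto simp: r_coset_def)
  then show ?thesis
    using assms centerD(1) by (simp add: commutator_mult_left commutator_of_center)
qed

end

text \<open>Once trivial, the lower central series stays trivial, so its term with index 2 is
  trivial whatever the exact class. That term contains the commutator of any commutator with any
  element.\<close>

lemma class2_groupI:
  assumes "nilpotent G" "nilpotency_class G \<le> 2"
  shows "class2_group G"
proof -
  interpret group G using assms(1) by (simp add: nilpotent_def)
  have one: "lower_central G (Suc k) = {\<one>\<^bsub>G\<^esub>}" if "lower_central G k = {\<one>\<^bsub>G\<^esub>}" for k
  proof -
    have "(\<Union>x\<in>{\<one>\<^bsub>G\<^esub>}. \<Union>y\<in>carrier G. {x \<otimes>\<^bsub>G\<^esub> y \<otimes>\<^bsub>G\<^esub> inv\<^bsub>G\<^esub> x \<otimes>\<^bsub>G\<^esub> inv\<^bsub>G\<^esub> y}) = {\<one>\<^bsub>G\<^esub>}"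
      by (auto intro: exI[of _ "\<one>\<^bsub>G\<^esub>"])
    then show ?thesis using that generate_one by simp
  qed
  have mono: "lower_central G k = {\<one>\<^bsub>G\<^esub>}" if "lower_central G i = {\<one>\<^bsub>G\<^esub>}" "i \<le> k" for i k
    using that(2)
  proof (induction k rule: dec_induct)
    case base
    show ?case by fact
  next
    case (step k)
    then show ?case by (intro one)
  qed
  have "\<exists>k. lower_central G k = {\<one>\<^bsub>G\<^esub>}" using assms(1) by (simp add: nilpotent_def)
  then have "lower_central G (nilpotency_class G) = {\<one>\<^bsub>G\<^esub>}"
    unfolding nilpotency_class_def by (rule LeastI_ex)
  then have 2: "lower_central G (Suc (Suc 0)) = {\<one>\<^bsub>G\<^esub>}"
    by (rule mono) (use assms(2) in simp)
  show ?thesis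
  proof (unfold_locales)
    fix x y assume xy: "x \<in> carrier G" "y \<in> carrier G"
    define c where "c = x \<otimes>\<^bsub>G\<^esub> y \<otimes>\<^bsub>G\<^esub> inv\<^bsub>G\<^esub> x \<otimes>\<^bsub>G\<^esub> inv\<^bsub>G\<^esub> y"
    have c: "c \<in> carrier G" using xy by (simp add: c_def)
    have c1: "c \<in> lower_central G (Suc 0)"
      unfolding lower_central.simps c_def using xy by (intro generate.incl) auto
    have "c \<otimes>\<^bsub>G\<^esub> w = w \<otimes>\<^bsub>G\<^esub> c" if w: "w \<in> carrier G" for w
    proof -
      have "c \<otimes>\<^bsub>G\<^esub> w \<otimes>\<^bsub>G\<^esub> inv\<^bsub>G\<^esub> c \<otimes>\<^bsub>G\<^esub> inv\<^bsub>G\<^esub> w \<in> lower_central G (Suc (Suc 0))"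
        unfolding lower_central.simps(2)[of G "Suc 0"] using c1 w by (intro generate.incl) blast
      then have "c \<otimes>\<^bsub>G\<^esub> w \<otimes>\<^bsub>G\<^esub> inv\<^bsub>G\<^esub> (w \<otimes>\<^bsub>G\<^esub> c) = \<one>\<^bsub>G\<^esub>"
        using c w unfolding 2 by (simp add: inv_mult_group m_assoc)
      then show ?thesis using c w inv_solve_right[of "\<one>\<^bsub>G\<^esub>" "c \<otimes>\<^bsub>G\<^esub> w" "w \<otimes>\<^bsub>G\<^esub> c"] by simp
    qed
    then show "c \<in> center G" using c by (simp add: center_def)
  qed
qed

section \<open>Radicals and polarisation\<close>

context class2_group
begin

text \<open>The radical \<open>N\<close> of \<open>f\<close> in its first argument contains the
  centre. The quotient by \<open>N\<close> is therefore abelian, commutators being central, and is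
  an image of the quotient by the centre, which bounds its rank. Assuming multiplicativity in one
  argument only lets the lemma serve for both radicals of a bilinear map.\<close>

lemma radical_quotient:
  assumes fin: "finite (carrier G)"
    and f_center: "\<And>x y. x \<in> carrier G \<Longrightarrow> y \<in> carrier G \<Longrightarrow> f x y \<in> center G"
    and f_mult: "\<And>x x' y. x \<in> carrier G \<Longrightarrow> x' \<in> carrier G \<Longrightarrow> y \<in> carrier G \<Longrightarrow>
      f (x \<otimes> x') y = f x y \<otimes> f x' y"
    and f_one: "\<And>z y. z \<in> center G \<Longrightarrow> y \<in> carrier G \<Longrightarrow> f z y = \<one>"
  obtains A :: "nat monoid" and \<alpha> where "comm_group A" "\<alpha> \<in> hom G A" "\<alpha> ` carrier G = carrier A"
    "\<And>x. x \<in> carrier G \<Longrightarrow> \<alpha> x = \<one>\<^bsub>A\<^esub> \<longleftrightarrow> (\<forall>y\<in>carrier G. f x y = \<one>)"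
    "\<And>x x' y. x \<in> carrier G \<Longrightarrow> x' \<in> carrier G \<Longrightarrow> y \<in> carrier G \<Longrightarrow> \<alpha> x = \<alpha> x' \<Longrightarrow> f x y = f x' y"
    "gen_rank A \<le> gen_rank (G Mod center G)"
proof -
  define N where "N = {x \<in> carrier G. \<forall>y\<in>carrier G. f x y = \<one>}"
  have f_closed: "f x y \<in> carrier G" if "x \<in> carrier G" "y \<in> carrier G" for x y
    using f_center[OF that] centerD(1) by blast
  have center_N: "center G \<subseteq> N" using f_one centerD(1) by (auto simp: N_def)
  have f_inv: "f (inv x) y = inv (f x y)" if "x \<in> carrier G" "y \<in> carrier G" for x y
  proof -
    have "f (inv x) y \<otimes> f x y = f \<one> y" using that by (simp flip: f_mult)
    also have "\<dots> = \<one>" using that f_one subgroup.one_closed[OF subgroup_center] by blast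
    finally show ?thesis using inv_equality f_closed that by simp
  qed
  have "subgroup N G"
  proof (rule subgroupI)
    show "N \<noteq> {}" using center_N subgroup.one_closed[OF subgroup_center] by blast
  qed (auto simp: N_def f_mult f_inv)
  then have "N \<lhd> G"
  proof (rule normal_invI)
    fix x h assume xh: "x \<in> carrier G" "h \<in> N"
    then have h: "h \<in> carrier G" by (simp add: N_def)
    have "f (x \<otimes> h \<otimes> inv x) y = \<one>" if "y \<in> carrier G" for y
      using xh h that f_closed by (simp add: f_mult f_inv) (simp add: N_def)
    then show "x \<otimes> h \<otimes> inv x \<in> N" using xh h by (simp add: N_def)
  qed
  then obtain A :: "nat monoid" and \<alpha> where A: "group A" "\<alpha> \<in> hom G A" "\<alpha> ` carrier G = carrier A"
    and ker: "\<And>x. x \<in> carrier G \<Longrightarrow> \<alpha> x = \<one>\<^bsub>A\<^esub> \<longleftrightarrow> x \<in> N"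
    using nat_quotient[OF _ fin] by metis
  interpret \<alpha>: group_hom G A \<alpha>
    using A is_group by (simp add: group_hom_def group_hom_axioms_def)
  have comm: "comm_group A"
  proof (rule group.group_comm_groupI[OF A(1)])
    fix a b assume "a \<in> carrier A" "b \<in> carrier A"
    then obtain x y where xy: "x \<in> carrier G" "y \<in> carrier G" "a = \<alpha> x" "b = \<alpha> y"
      unfolding A(3)[symmetric] by blast
    have c: "\<alpha> (commutator x y) = \<one>\<^bsub>A\<^esub>"
      using xy center_N ker by (meson commutator_center commutator_closed subsetD)
    have "a \<otimes>\<^bsub>A\<^esub> b = \<alpha> (x \<otimes> y)" using xy by simp
    also have "x \<otimes> y = commutator x y \<otimes> (y \<otimes> x)" using xy by (intro commutator_swap)
    also have "\<alpha> (commutator x y \<otimes> (y \<otimes> x)) = b \<otimes>\<^bsub>A\<^esub> a" using xy c by simp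
    finally show "a \<otimes>\<^bsub>A\<^esub> b = b \<otimes>\<^bsub>A\<^esub> a" .
  qed
  have cong: "f x y = f x' y"
    if "x \<in> carrier G" "x' \<in> carrier G" "y \<in> carrier G" "\<alpha> x = \<alpha> x'" for x x' y
  proof -
    have "\<alpha> (x \<otimes> inv x') = \<one>\<^bsub>A\<^esub>" using that by simp
    then have "x \<otimes> inv x' \<in> N" using ker[of "x \<otimes> inv x'"] that(1,2) by blast
    then have 1: "f (x \<otimes> inv x') y = \<one>" using that by (simp add: N_def)
    have "f x y = f ((x \<otimes> inv x') \<otimes> x') y" using that by (simp add: m_assoc)
    also have "\<dots> = f (x \<otimes> inv x') y \<otimes> f x' y" using that by (intro f_mult) auto
    finally show ?thesis using 1 that f_closed by simp
  qed
  \<comment> \<open>\<open>\<alpha>\<close> factors through the quotient by the centre, so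
    \<open>gen_rank_epi\<close> applies to the induced map.\<close>
  have "center G \<subseteq> kernel G A \<alpha>" using center_N ker centerD(1) by (auto simp: kernel_def)
  then obtain g where g: "g \<in> hom (G Mod center G) A" "\<And>x. x \<in> carrier G \<Longrightarrow> g (center G #> x) = \<alpha> x"
    using \<alpha>.FactGroup_universal_kernel[OF normal_center] by metis
  have "g ` carrier (G Mod center G) = \<alpha> ` carrier G"
    using g(2) by (simp add: carrier_FactGroup image_image)
  then have rank: "gen_rank A \<le> gen_rank (G Mod center G)"
    using A g(1) normal.factorgroup_is_group[OF normal_center] by (intro gen_rank_epi) auto
  show thesis
  proof (rule that[OF comm A(2,3) _ cong rank])
    fix x assume "x \<in> carrier G"
    then show "\<alpha> x = \<one>\<^bsub>A\<^esub> \<longleftrightarrow> (\<forall>y\<in>carrier G. f x y = \<one>)" using ker by (simp add: N_def)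
  qed
qed

end

text \<open>\<open>m\<close> is one half of the commutator form. It is a bilinear map on the
  quotient by the centre, written on \<open>G\<close> itself; the last two assumptions make it
  constant on cosets.\<close>

locale polarised_group = class2_group +
  fixes m
  assumes m_derived: "x \<in> carrier G \<Longrightarrow> y \<in> carrier G \<Longrightarrow> m x y \<in> derived G (carrier G)"
    and m_mult_left: "x \<in> carrier G \<Longrightarrow> x' \<in> carrier G \<Longrightarrow> y \<in> carrier G \<Longrightarrow>
      m (x \<otimes> x') y = m x y \<otimes> m x' y"
    and m_mult_right: "x \<in> carrier G \<Longrightarrow> y \<in> carrier G \<Longrightarrow> y' \<in> carrier G \<Longrightarrow>
      m x (y \<otimes> y') = m x y \<otimes> m x y'"
    and m_skew: "x \<in> carrier G \<Longrightarrow> y \<in> carrier G \<Longrightarrow> m x y = commutator x y \<otimes> m y x"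
    and m_center_left: "z \<in> center G \<Longrightarrow> y \<in> carrier G \<Longrightarrow> m z y = \<one>"
    and m_center_right: "z \<in> center G \<Longrightarrow> y \<in> carrier G \<Longrightarrow> m y z = \<one>"

context class2_group
begin

text \<open>The commutator induces an alternating form on the quotient by the centre with values in
  the derived subgroup; half of it, given by \<open>alternating_eq_bilinear_diff\<close>, is pulled
  back to \<open>G\<close>.\<close>

lemma polarisation:
  assumes fin: "finite (carrier G)"
  obtains m where "polarised_group G m"
proof -
  interpret Z: normal "center G" G by (rule normal_center)
  let ?V = "G Mod center G" and ?D = "G\<lparr>carrier := derived G (carrier G)\<rparr>"
  interpret V: comm_group ?V by (rule comm_group_Mod_center)
  interpret D: comm_group ?D
    by (rule comm_group_restrict_center[OF subgroup_derived derived_subset_center])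
  \<comment> \<open>Chosen representatives make the commutator a function of cosets; the fact
    \<open>b\<close> below shows that the choice does not matter.\<close>
  define rep where "rep = (\<lambda>U. SOME x. x \<in> carrier G \<and> U = center G #> x)"
  have rep: "rep U \<in> carrier G" "center G #> rep U = U" if "U \<in> carrier ?V" for U
  proof -
    have "\<exists>x. x \<in> carrier G \<and> U = center G #> x" using that by (auto simp: carrier_FactGroup)
    then have "rep U \<in> carrier G \<and> U = center G #> rep U" unfolding rep_def by (rule someI_ex)
    then show "rep U \<in> carrier G" "center G #> rep U = U" by auto
  qed
  define b where "b = (\<lambda>U W. commutator (rep U) (rep W))"
  have V: "center G #> x \<in> carrier ?V" if "x \<in> carrier G" for x
    using that by (simp add: carrier_FactGroup)
  have b: "b (center G #> x) (center G #> y) = commutator x y" if "x \<in> carrier G" "y \<in> carrier G" for x y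
  proof -
    \<comment> \<open>Congruence is available in the first argument; for the second the arguments
      are exchanged and exchanged back.\<close>
    have "b (center G #> x) (center G #> y) = commutator x (rep (center G #> y))"
      unfolding b_def using that V rep by (intro commutator_coset_cong) auto
    also have "\<dots> = inv (commutator (rep (center G #> y)) x)"
      using that V rep by (intro commutator_inverse) auto
    also have "commutator (rep (center G #> y)) x = commutator y x"
      using that V rep by (intro commutator_coset_cong) auto
    also have "inv (commutator y x) = commutator x y"
      using commutator_inverse[OF that] by simp
    finally show ?thesis .
  qed
  have homr: "b U \<in> hom ?V ?D" if U: "U \<in> carrier ?V" for U
  proof (rule homI)
    fix W W' assume "W \<in> carrier ?V" "W' \<in> carrier ?V"
    then obtain x y y' where xy: "x \<in> carrier G" "y \<in> carrier G" "y' \<in> carrier G"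
      "U = center G #> x" "W = center G #> y" "W' = center G #> y'"
      using U by (auto simp: carrier_FactGroup)
    then show "b U (W \<otimes>\<^bsub>?V\<^esub> W') = b U W \<otimes>\<^bsub>?D\<^esub> b U W'"
      by (simp add: Z.rcos_sum b commutator_mult_right)
  qed (use U rep in \<open>simp add: b_def commutator_in_derived\<close>)
  have homl: "(\<lambda>U. b U W) \<in> hom ?V ?D" if W: "W \<in> carrier ?V" for W
  proof (rule homI)
    fix U U' assume "U \<in> carrier ?V" "U' \<in> carrier ?V"
    then obtain y x x' where xy: "y \<in> carrier G" "x \<in> carrier G" "x' \<in> carrier G"
      "W = center G #> y" "U = center G #> x" "U' = center G #> x'"
      using W by (auto simp: carrier_FactGroup)
    then show "b (U \<otimes>\<^bsub>?V\<^esub> U') W = b U W \<otimes>\<^bsub>?D\<^esub> b U' W"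
      by (simp add: Z.rcos_sum b commutator_mult_left)
  qed (use W rep in \<open>simp add: b_def commutator_in_derived\<close>)
  have alt: "b U U = \<one>\<^bsub>?D\<^esub>" if "U \<in> carrier ?V" for U
    using rep[OF that] by (simp add: b_def commutator_self)
  have finV: "finite (carrier ?V)" using fin by (simp add: carrier_FactGroup)
  obtain \<mu> where \<mu>r: "\<And>u. u \<in> carrier ?V \<Longrightarrow> \<mu> u \<in> hom ?V ?D"
    and \<mu>l: "\<And>v. v \<in> carrier ?V \<Longrightarrow> (\<lambda>u. \<mu> u v) \<in> hom ?V ?D"
    and \<mu>: "\<And>u v. u \<in> carrier ?V \<Longrightarrow> v \<in> carrier ?V \<Longrightarrow> \<mu> u v = b u v \<otimes>\<^bsub>?D\<^esub> \<mu> v u"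
    using V.alternating_eq_bilinear_diff[OF finV D.comm_group_axioms homr homl alt] by metis
  have central: "center G #> z = \<one>\<^bsub>?V\<^esub>" if "z \<in> center G" for z
    using that centerD(1) by (simp add: coset_join2 subgroup_center)
  show thesis
  proof (rule that[of "\<lambda>x y. \<mu> (center G #> x) (center G #> y)"], unfold_locales)
    fix x y assume xy: "x \<in> carrier G" "y \<in> carrier G"
    show "\<mu> (center G #> x) (center G #> y) \<in> derived G (carrier G)"
      using hom_in_carrier[OF \<mu>r] xy V by fastforce
    show "\<mu> (center G #> x) (center G #> y) = commutator x y \<otimes> \<mu> (center G #> y) (center G #> x)"
      using \<mu>[OF V V, OF xy] xy by (simp add: b)
    fix w assume w: "w \<in> carrier G"
    show "\<mu> (center G #> (x \<otimes> y)) (center G #> w) =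
        \<mu> (center G #> x) (center G #> w) \<otimes> \<mu> (center G #> y) (center G #> w)"
      using hom_mult[OF \<mu>l[OF V[OF w]] V[OF xy(1)] V[OF xy(2)]] xy by (simp add: Z.rcos_sum)
    show "\<mu> (center G #> w) (center G #> (x \<otimes> y)) =
        \<mu> (center G #> w) (center G #> x) \<otimes> \<mu> (center G #> w) (center G #> y)"
      using hom_mult[OF \<mu>r[OF V[OF w]] V[OF xy(1)] V[OF xy(2)]] xy by (simp add: Z.rcos_sum)
  next
    fix z y assume zy: "z \<in> center G" "y \<in> carrier G"
    show "\<mu> (center G #> z) (center G #> y) = \<one>"
      using hom_one[OF \<mu>l[OF V[OF zy(2)]] V.is_group D.is_group] zy(1) by (simp add: central del: one_FactGroup)
    show "\<mu> (center G #> y) (center G #> z) = \<one>"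
      using hom_one[OF \<mu>r[OF V[OF zy(2)]] V.is_group D.is_group] zy(1) by (simp add: central del: one_FactGroup)
  qed
qed

end

section \<open>The untwisted group and its characters\<close>

context polarised_group
begin

lemma m_center: "x \<in> carrier G \<Longrightarrow> y \<in> carrier G \<Longrightarrow> m x y \<in> center G"
  using m_derived derived_subset_center by blast

lemma m_closed' [simp]: "x \<in> carrier G \<Longrightarrow> y \<in> carrier G \<Longrightarrow> m x y \<in> carrier G"
  using m_center centerD(1) by blast

lemma inv_m_center: "x \<in> carrier G \<Longrightarrow> y \<in> carrier G \<Longrightarrow> inv (m x y) \<in> center G"
  using m_center subgroup.m_inv_closed[OF subgroup_center] by blast

lemma m_inv_left: "x \<in> carrier G \<Longrightarrow> y \<in> carrier G \<Longrightarrow> m (inv x) y = inv (m x y)"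
proof -
  assume xy: "x \<in> carrier G" "y \<in> carrier G"
  have "m (inv x) y \<otimes> m x y = m \<one> y" using xy by (simp flip: m_mult_left)
  also have "\<dots> = \<one>" using xy m_center_left subgroup.one_closed[OF subgroup_center] by blast
  finally show ?thesis using inv_equality xy by simp
qed

text \<open>The abelian group \<open>E\<close> of the introduction.\<close>

definition untwist :: "'a monoid" where
  "untwist = \<lparr>carrier = carrier G, monoid.mult = (\<lambda>x y. x \<otimes> y \<otimes> inv (m x y)), one = \<one>\<rparr>"

lemma untwist_simps [simp]:
  "carrier untwist = carrier G" "x \<otimes>\<^bsub>untwist\<^esub> y = x \<otimes> y \<otimes> inv (m x y)" "\<one>\<^bsub>untwist\<^esub> = \<one>"
  by (simp_all add: untwist_def)

lemma m_mult_center_left: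
  "x \<in> carrier G \<Longrightarrow> z \<in> center G \<Longrightarrow> y \<in> carrier G \<Longrightarrow> m (x \<otimes> z) y = m x y"
  using centerD(1) by (simp add: m_mult_left m_center_left)

lemma m_mult_center_right:
  "x \<in> carrier G \<Longrightarrow> z \<in> center G \<Longrightarrow> y \<in> carrier G \<Longrightarrow> m y (x \<otimes> z) = m y x"
  using centerD(1) by (simp add: m_mult_right m_center_right)

text \<open>Associativity rests on the bilinearity of \<open>m\<close>, commutativity on
  \<open>m_skew\<close>.\<close>

lemma comm_group_untwist: "comm_group untwist"
proof (rule comm_groupI, unfold untwist_simps)
  show "x \<otimes> y \<otimes> inv (m x y) \<in> carrier G" if "x \<in> carrier G" "y \<in> carrier G" for x y
    using that by simp
  show "\<one> \<in> carrier G" by simp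
  fix x y w assume x: "x \<in> carrier G" and y: "y \<in> carrier G" and w: "w \<in> carrier G"
  let ?a = "inv (m x y)" and ?b = "inv (m x w)" and ?c = "inv (m y w)"
  note z = inv_m_center[OF x y] inv_m_center[OF x w] inv_m_center[OF y w]
  note c = z[THEN centerD(1)]
  \<comment> \<open>Both bracketings equal \<open>x \<otimes> y \<otimes> w\<close> divided by the
    central elements \<open>m x y\<close>, \<open>m x w\<close> and \<open>m y w\<close>.\<close>
  have "x \<otimes> y \<otimes> ?a \<otimes> w \<otimes> inv (m (x \<otimes> y \<otimes> ?a) w) = x \<otimes> (y \<otimes> (?a \<otimes> w)) \<otimes> (?c \<otimes> ?b)"
    using x y w z by (simp add: m_mult_center_left m_mult_left inv_mult_group m_assoc)
  also have "\<dots> = x \<otimes> (y \<otimes> (w \<otimes> ?a)) \<otimes> (?c \<otimes> ?b)" using centerD(2)[OF z(1) w] by simp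
  also have "\<dots> = x \<otimes> (y \<otimes> (w \<otimes> (?a \<otimes> (?c \<otimes> ?b))))" using x y w c by (simp add: m_assoc)
  also have "?a \<otimes> (?c \<otimes> ?b) = ?c \<otimes> ?b \<otimes> ?a" using centerD(2)[OF z(1), of "?c \<otimes> ?b"] c by simp
  also have "x \<otimes> (y \<otimes> (w \<otimes> (?c \<otimes> ?b \<otimes> ?a))) = x \<otimes> (y \<otimes> w \<otimes> ?c) \<otimes> (?b \<otimes> ?a)"
    using x y w c by (simp add: m_assoc)
  also have "\<dots> = x \<otimes> (y \<otimes> w \<otimes> ?c) \<otimes> inv (m x (y \<otimes> w \<otimes> ?c))"
    using x y w z by (simp add: m_mult_center_right m_mult_right inv_mult_group)
  finally show "x \<otimes> y \<otimes> ?a \<otimes> w \<otimes> inv (m (x \<otimes> y \<otimes> ?a) w) = x \<otimes> (y \<otimes> w \<otimes> ?c) \<otimes> inv (m x (y \<otimes> w \<otimes> ?c))" .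
next
  fix x y assume x: "x \<in> carrier G" and y: "y \<in> carrier G"
  \<comment> \<open>Exchanging \<open>x\<close> and \<open>y\<close> costs the same commutator in
    the product and in \<open>m\<close>, and the two cancel.\<close>
  have "x \<otimes> y \<otimes> inv (m x y) = (y \<otimes> x \<otimes> commutator x y) \<otimes> inv (m y x \<otimes> commutator x y)"
    using x y commutator_swap[OF x y] m_skew[OF x y] centerD(2)[of "commutator x y"] by simp
  also have "\<dots> = y \<otimes> x \<otimes> (commutator x y \<otimes> inv (commutator x y)) \<otimes> inv (m y x)"
    using x y by (simp only: inv_mult_group m_assoc commutator_closed m_closed' m_closed inv_closed)
  also have "\<dots> = y \<otimes> x \<otimes> inv (m y x)" using x y by simp
  finally show "x \<otimes> y \<otimes> inv (m x y) = y \<otimes> x \<otimes> inv (m y x)" .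
next
  fix x assume x: "x \<in> carrier G"
  have one: "\<one> \<in> center G" by (rule subgroup.one_closed[OF subgroup_center])
  show "\<one> \<otimes> x \<otimes> inv (m \<one> x) = x" using m_center_left[OF one x] x by simp
  note q = m_center[OF x x] m_closed'[OF x x] inv_m_center[OF x x]
  \<comment> \<open>The new inverse of \<open>x\<close> carries the extra factor
    \<open>inv (m x x)\<close>, since the new product of \<open>inv x\<close> and \<open>x\<close>
    is \<open>m x x\<close>.\<close>
  have "m (inv x \<otimes> inv (m x x)) x = inv (m x x)"
    using x q by (simp add: m_mult_center_left m_inv_left)
  moreover have "inv x \<otimes> inv (m x x) \<otimes> x = inv (m x x)"
  proof -
    have "inv x \<otimes> inv (m x x) \<otimes> x = inv x \<otimes> (x \<otimes> inv (m x x))"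
      using x q centerD(2)[OF q(3) x] by (simp add: m_assoc)
    then show ?thesis using x q by (simp flip: m_assoc)
  qed
  ultimately show "\<exists>y\<in>carrier G. y \<otimes> x \<otimes> inv (m y x) = \<one>"
    using x q by (intro bexI[of _ "inv x \<otimes> inv (m x x)"]) simp_all
qed

text \<open>The step from \<open>k\<close> to \<open>Suc k\<close> divides by
  \<open>m (x [^] k) x\<close>, which is the \<open>k\<close>-th power of \<open>m x x\<close>;
  these exponents add up to a triangular number.\<close>

lemma untwist_pow:
  assumes x: "x \<in> carrier G"
  shows "x [^]\<^bsub>untwist\<^esub> (k::nat) = x [^] k \<otimes> inv (m x x [^] (\<Sum>{..<k}))"
proof (induction k)
  case (Suc k)
  let ?d = "inv (m x x [^] (\<Sum>{..<k}))"
  have q: "m x x [^] (i::nat) \<in> center G" for i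
    using subgroup_int_pow_closed[OF subgroup_center m_center[OF x x], of "int i"] by (simp add: int_pow_int)
  have d: "?d \<in> center G" using q subgroup.m_inv_closed[OF subgroup_center] by blast
  have pow: "m (x [^] i) x = m x x [^] i" for i :: nat
    by (induction i) (use x m_center_left subgroup.one_closed[OF subgroup_center] in \<open>simp_all add: m_mult_left\<close>)
  have "x [^]\<^bsub>untwist\<^esub> Suc k = x [^] k \<otimes> (?d \<otimes> x) \<otimes> inv (m x x [^] k)"
    using x d centerD(1)[OF d] by (simp add: Suc m_mult_center_left pow m_assoc)
  also have "?d \<otimes> x = x \<otimes> ?d" using centerD(2)[OF d x] .
  also have "x [^] k \<otimes> (x \<otimes> ?d) \<otimes> inv (m x x [^] k) = x [^] Suc k \<otimes> inv (m x x [^] k \<otimes> m x x [^] (\<Sum>{..<k}))"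
    using x by (simp add: m_assoc inv_mult_group)
  also have "m x x [^] k \<otimes> m x x [^] (\<Sum>{..<k}) = m x x [^] (\<Sum>{..<Suc k})"
    using x by (simp add: nat_pow_mult add.commute)
  finally show ?case .
qed simp

text \<open>The correction factor in \<open>untwist_pow\<close> is a triangular power of an element
  of the derived subgroup, hence trivial by \<open>derived_triangular_power\<close>.\<close>

lemma untwist_exponent:
  assumes "\<And>x. x \<in> carrier G \<Longrightarrow> x [^] (n::nat) = \<one>" "x \<in> carrier G"
  shows "x [^]\<^bsub>untwist\<^esub> n = \<one>"
  using assms derived_triangular_power[OF assms(1) m_derived[OF assms(2,2)]] by (simp add: untwist_pow)

text \<open>Writes the product of \<open>G\<close> in terms of \<open>untwist\<close>; under a
  homomorphism on \<open>untwist\<close> it becomes the third coordinate of the Heisenberg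
  product.\<close>

lemma mult_eq_untwist:
  assumes "x \<in> carrier G" "y \<in> carrier G"
  shows "x \<otimes> y = (x \<otimes>\<^bsub>untwist\<^esub> y) \<otimes>\<^bsub>untwist\<^esub> m x y"
  using assms m_center[OF assms] by (simp add: m_center_right m_assoc)

text \<open>\<open>m\<close> is trivial on central elements, so both groups have the same products
  and inverses there.\<close>

lemma subgroup_center_untwist: "subgroup (center G) untwist"
proof -
  interpret E: comm_group untwist by (rule comm_group_untwist)
  show ?thesis
  proof (rule E.subgroupI)
    fix a b assume ab: "a \<in> center G" "b \<in> center G"
    then show "a \<otimes>\<^bsub>untwist\<^esub> b \<in> center G"
      using centerD(1) subgroup.m_closed[OF subgroup_center] by (simp add: m_center_left)
    have "inv a \<in> center G" using ab subgroup.m_inv_closed[OF subgroup_center] by blast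
    moreover have "inv\<^bsub>untwist\<^esub> a = inv a"
      using ab centerD(1) \<open>inv a \<in> center G\<close> by (intro E.inv_equality) (simp_all add: m_center_left)
    ultimately show "inv\<^bsub>untwist\<^esub> a \<in> center G" by simp
  qed (use centerD(1) subgroup.one_closed[OF subgroup_center] in auto)
qed

text \<open>A minimal generating set of the centre with \<open>d\<close> elements gives
  \<open>d\<close> separating characters. They extend to \<open>untwist\<close> and together map it
  to a homocyclic group of rank \<open>d\<close>, injectively on the centre.\<close>

lemma center_character_embedding:
  assumes fin: "finite (carrier G)" and n: "0 < n" "\<And>x. x \<in> carrier G \<Longrightarrow> x [^] (n::nat) = \<one>"
  obtains C :: "nat monoid" and \<kappa> where "comm_group C" "\<kappa> \<in> hom untwist C"
    "\<And>z. z \<in> center G \<Longrightarrow> \<kappa> z = \<one>\<^bsub>C\<^esub> \<Longrightarrow> z = \<one>"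
    "gen_rank C = gen_rank (G\<lparr>carrier := center G\<rparr>)"
    "\<And>c. c \<in> carrier C \<Longrightarrow> c [^]\<^bsub>C\<^esub> n = \<one>\<^bsub>C\<^esub>"
proof -
  let ?Z = "G\<lparr>carrier := center G\<rparr>"
  interpret Z: comm_group ?Z
    by (rule comm_group_restrict_center[OF subgroup_center order_refl])
  interpret E: comm_group untwist by (rule comm_group_untwist)
  have finZ: "finite (carrier ?Z)" using fin finite_subset[OF subgroup.subset[OF subgroup_center]] by simp
  obtain S where S: "finite S" "S \<subseteq> carrier ?Z" "generate ?Z S = carrier ?Z"
    and rank: "gen_rank ?Z = enat (card S)"
    using Z.gen_rank_attained[OF finZ] by metis
  define d where "d = card S"
  have powZ: "x [^]\<^bsub>?Z\<^esub> n = \<one>\<^bsub>?Z\<^esub>" if "x \<in> carrier ?Z" for x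
    using that n(2)[OF centerD(1)] nat_pow_consistent[of x n "center G"] by simp
  obtain \<chi> where \<chi>: "\<And>i. i < d \<Longrightarrow> \<chi> i \<in> hom ?Z (integer_mod_group n)"
    and sep: "\<And>u. u \<in> center G \<Longrightarrow> (\<forall>i<d. \<chi> i u = 0) \<Longrightarrow> u = \<one>"
    using Z.separating_characters[OF finZ n(1) powZ S(1,2), of d] unfolding S(3)
    by (auto simp: d_def)
  have "\<exists>g\<in>hom untwist (integer_mod_group n). \<forall>z\<in>center G. g z = \<chi> i z" if "i < d" for i
  proof (rule E.character_extension)
    show "\<chi> i \<in> hom (untwist\<lparr>carrier := center G\<rparr>) (integer_mod_group n)"
      using \<chi>[OF that] centerD(1) by (auto simp: hom_def m_center_left)
  qed (use fin n untwist_exponent subgroup_center_untwist in auto)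
  then obtain g where g: "\<And>i. i < d \<Longrightarrow> g i \<in> hom untwist (integer_mod_group n)"
    "\<And>i z. i < d \<Longrightarrow> z \<in> center G \<Longrightarrow> g i z = \<chi> i z"
    by metis
  define P where "P = product_group {..<d} (\<lambda>_. integer_mod_group n)"
  interpret P: comm_group P unfolding P_def by (rule homocyclic_comm_group[OF n(1)])
  define \<kappa> where "\<kappa> = (\<lambda>x. \<lambda>i\<in>{..<d}. g i x)"
  have \<kappa>: "\<kappa> \<in> hom untwist P" unfolding \<kappa>_def P_def using n(1) g(1) by (rule homocyclic_hom)
  have \<kappa>_inj: "z = \<one>" if "z \<in> center G" "\<kappa> z = \<one>\<^bsub>P\<^esub>" for z
  proof (rule sep[OF that(1)], intro allI impI)
    fix i assume "i < d"
    then show "\<chi> i z = 0" using fun_cong[OF that(2), of i] g(2) that(1) by (simp add: \<kappa>_def P_def)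
  qed
  \<comment> \<open>For \<open>n = 1\<close> the group is trivial, and \<open>d\<close> vanishes
    because \<open>S\<close> was chosen minimal.\<close>
  have d0: "1 < n \<or> d = 0"
  proof (cases "n = 1")
    case True
    have "x = \<one>" if "x \<in> carrier G" for x using n(2)[OF that] that True by simp
    then have "generate ?Z {} = carrier ?Z"
      using centerD(1) subgroup.one_closed[OF subgroup_center] by (auto simp: Z.generate_empty)
    then have "gen_rank ?Z \<le> enat (card ({} :: 'a set))" by (intro gen_rank_le) auto
    then show ?thesis using rank by (simp add: d_def enat_0_iff)
  qed (use n in auto)
  \<comment> \<open>Dividing by the trivial subgroup merely renames elements: \<open>C\<close> is a
    copy of \<open>P\<close> on \<open>nat\<close>.\<close>
  have triv: "{\<one>\<^bsub>P\<^esub>} \<lhd> P" by (rule P.one_is_normal)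
  have finP: "finite (carrier P)" unfolding P_def by (rule homocyclic_card[OF n(1)])
  obtain C :: "nat monoid" and e where C: "group C" "e \<in> hom P C" "e ` carrier P = carrier C"
    and ker: "\<And>x. x \<in> carrier P \<Longrightarrow> e x = \<one>\<^bsub>C\<^esub> \<longleftrightarrow> x \<in> {\<one>\<^bsub>P\<^esub>}"
    using P.nat_quotient[OF triv finP] by metis
  interpret e: group_hom P C e using C by (simp add: group_hom_def group_hom_axioms_def)
  have "e \<in> iso P C" using C(3) ker by (simp add: e.iso_iff)
  \<comment> \<open>The isomorphism and its inverse are epimorphisms and give the two
    inequalities.\<close>
  then have "gen_rank C = gen_rank P"
    using gen_rank_epi[OF P.is_group C(1,2,3)] P.iso_set_sym[OF \<open>e \<in> iso P C\<close>]
      gen_rank_epi[OF C(1) P.is_group, of "inv_into (carrier P) e"]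
    by (simp add: iso_def bij_betw_def antisym)
  also have "\<dots> = gen_rank ?Z" unfolding P_def using homocyclic_gen_rank[OF n(1) d0] rank by (simp add: d_def)
  finally have rankC: "gen_rank C = gen_rank ?Z" .
  show thesis
  proof (rule that[of C "e \<circ> \<kappa>"])
    show "comm_group C"
    proof (rule group.group_comm_groupI[OF C(1)])
      fix a b assume "a \<in> carrier C" "b \<in> carrier C"
      then obtain x y where "x \<in> carrier P" "y \<in> carrier P" "a = e x" "b = e y"
        unfolding C(3)[symmetric] by blast
      then show "a \<otimes>\<^bsub>C\<^esub> b = b \<otimes>\<^bsub>C\<^esub> a" by (metis P.m_comm e.hom_mult)
    qed
    show "e \<circ> \<kappa> \<in> hom untwist C" using \<kappa> C(2) by (rule Group.hom_compose)
    show "gen_rank C = gen_rank ?Z" by (rule rankC)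
    fix z assume z: "z \<in> center G" "(e \<circ> \<kappa>) z = \<one>\<^bsub>C\<^esub>"
    have "\<kappa> z \<in> carrier P" using hom_in_carrier[OF \<kappa>] centerD(1)[OF z(1)] by simp
    then show "z = \<one>" using z ker \<kappa>_inj by simp
  next
    fix c assume "c \<in> carrier C"
    then obtain x where x: "x \<in> carrier P" "c = e x" unfolding C(3)[symmetric] by blast
    have "x [^]\<^bsub>P\<^esub> n = \<one>\<^bsub>P\<^esub>" using x(1) unfolding P_def by (rule homocyclic_exponent[OF n(1)])
    then show "c [^]\<^bsub>C\<^esub> n = \<one>\<^bsub>C\<^esub>" using x e.hom_nat_pow[of x n] by simp
  qed
qed

lemma heisenberg_embedding:
  assumes fin: "finite (carrier G)"
  shows "\<exists>(A :: nat monoid) (B :: nat monoid) (C :: nat monoid) (\<mu> :: nat \<Rightarrow> nat \<Rightarrow> nat).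
    comm_group A \<and> comm_group B \<and> comm_group C \<and> bilinear A B C \<mu> \<and>
    nondegenerate A B C \<mu> \<and>
    (\<exists>K. subgroup K (heisenberg A B C \<mu>) \<and> G \<cong> (heisenberg A B C \<mu>)\<lparr>carrier := K\<rparr>) \<and>
    gen_rank (G Mod center G) \<ge> max (gen_rank A) (gen_rank B) \<and>
    gen_rank (G\<lparr>carrier := center G\<rparr>) = gen_rank C \<and>
    group_exponent (G Mod center G) dvd group_exponent (A \<times>\<times> B) \<and>
    group_exponent (A \<times>\<times> B) dvd group_exponent (G\<lparr>carrier := derived G (carrier G)\<rparr>) \<and>
    group_exponent (G\<lparr>carrier := derived G (carrier G)\<rparr>)
      dvd group_exponent (G\<lparr>carrier := center G\<rparr>) \<and>
    group_exponent (G\<lparr>carrier := center G\<rparr>) dvd group_exponent C \<and>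
    group_exponent C dvd group_exponent G"
proof -
  define n where "n = group_exponent G"
  have pow_n: "x [^] n = \<one>" if "x \<in> carrier G" for x
    using that group_exponent_dvd_iff[of n] by (simp add: n_def)
  \<comment> \<open>Positivity of \<open>n\<close> comes from finiteness, as the exponent divides
    the nonzero group order.\<close>
  have "n dvd order G" unfolding n_def group_exponent_dvd_iff using pow_order_eq_1 by blast
  moreover have "0 < order G" using fin order_gt_0_iff_finite by blast
  ultimately have n0: "0 < n" by (metis dvd_0_left_iff not_gr_zero)
  let ?Z = "G\<lparr>carrier := center G\<rparr>" and ?D = "G\<lparr>carrier := derived G (carrier G)\<rparr>"
  interpret Z: comm_group ?Z by (rule comm_group_restrict_center[OF subgroup_center order_refl])
  interpret D: comm_group ?D
    by (rule comm_group_restrict_center[OF subgroup_derived derived_subset_center])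
  interpret N: normal "center G" G by (rule normal_center)
  interpret E: comm_group untwist by (rule comm_group_untwist)

  \<comment> \<open>The three abelian groups\<close>
  obtain A :: "nat monoid" and \<alpha> where A: "comm_group A" "\<alpha> \<in> hom G A" "\<alpha> ` carrier G = carrier A"
    and \<alpha>_one: "\<And>x. x \<in> carrier G \<Longrightarrow> \<alpha> x = \<one>\<^bsub>A\<^esub> \<longleftrightarrow> (\<forall>y\<in>carrier G. m x y = \<one>)"
    and \<alpha>_cong: "\<And>x x' y. x \<in> carrier G \<Longrightarrow> x' \<in> carrier G \<Longrightarrow> y \<in> carrier G \<Longrightarrow> \<alpha> x = \<alpha> x' \<Longrightarrow> m x y = m x' y"
    and rankA: "gen_rank A \<le> gen_rank (G Mod center G)"
    by (rule radical_quotient[where f = m, OF fin m_center m_mult_left m_center_left])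
      (assumption | rule that)+
  \<comment> \<open>The right radical is the left radical of \<open>m\<close> with its arguments
    exchanged.\<close>
  obtain B :: "nat monoid" and \<beta> where B: "comm_group B" "\<beta> \<in> hom G B" "\<beta> ` carrier G = carrier B"
    and \<beta>_one: "\<And>y. y \<in> carrier G \<Longrightarrow> \<beta> y = \<one>\<^bsub>B\<^esub> \<longleftrightarrow> (\<forall>x\<in>carrier G. m x y = \<one>)"
    and \<beta>_cong: "\<And>y y' x. y \<in> carrier G \<Longrightarrow> y' \<in> carrier G \<Longrightarrow> x \<in> carrier G \<Longrightarrow> \<beta> y = \<beta> y' \<Longrightarrow> m x y = m x y'"
    and rankB: "gen_rank B \<le> gen_rank (G Mod center G)"
    by (rule radical_quotient[where f = "\<lambda>x y. m y x", OF fin m_center m_mult_right m_center_right])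
      (assumption | rule that)+
  obtain C :: "nat monoid" and \<kappa> where C: "comm_group C" "\<kappa> \<in> hom untwist C"
    and \<kappa>_inj: "\<And>z. z \<in> center G \<Longrightarrow> \<kappa> z = \<one>\<^bsub>C\<^esub> \<Longrightarrow> z = \<one>"
    and rankC: "gen_rank C = gen_rank ?Z"
    and powC: "\<And>c. c \<in> carrier C \<Longrightarrow> c [^]\<^bsub>C\<^esub> n = \<one>\<^bsub>C\<^esub>"
    by (rule center_character_embedding[OF fin n0 pow_n]) (assumption | rule that)+
  interpret A: comm_group A by fact
  interpret B: comm_group B by fact
  interpret C: comm_group C by fact
  interpret \<alpha>: group_hom G A \<alpha>
    using A A.is_group is_group by (simp add: group_hom_def group_hom_axioms_def)
  interpret \<beta>: group_hom G B \<beta>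
    using B B.is_group is_group by (simp add: group_hom_def group_hom_axioms_def)
  interpret \<kappa>: group_hom untwist C \<kappa>
    using C C.is_group E.is_group by (simp add: group_hom_def group_hom_axioms_def)
  have \<kappa>_closed: "\<kappa> x \<in> carrier C" if "x \<in> carrier G" for x
    using \<kappa>.hom_closed[of x] that by simp
  have \<kappa>_center: "\<kappa> (z \<otimes> x) = \<kappa> z \<otimes>\<^bsub>C\<^esub> \<kappa> x" if "z \<in> center G" "x \<in> carrier G" for z x
    using \<kappa>.hom_mult[of z x] that centerD(1) by (simp add: m_center_left)
  have \<kappa>_mult: "\<kappa> (x \<otimes> y) = \<kappa> x \<otimes>\<^bsub>C\<^esub> \<kappa> (m x y) \<otimes>\<^bsub>C\<^esub> \<kappa> y" if "x \<in> carrier G" "y \<in> carrier G" for x y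
  proof -
    have "\<kappa> (x \<otimes> y) = \<kappa> ((x \<otimes>\<^bsub>untwist\<^esub> y) \<otimes>\<^bsub>untwist\<^esub> m x y)"
      by (rule arg_cong[OF mult_eq_untwist[OF that]])
    also have "\<dots> = \<kappa> x \<otimes>\<^bsub>C\<^esub> \<kappa> y \<otimes>\<^bsub>C\<^esub> \<kappa> (m x y)"
      using that \<kappa>.hom_mult[of "x \<otimes>\<^bsub>untwist\<^esub> y" "m x y"] \<kappa>.hom_mult[of x y]
      by (simp del: \<kappa>.hom_mult)
    finally show ?thesis using that \<kappa>_closed by (simp add: C.m_ac)
  qed

  \<comment> \<open>The bilinear map\<close>
  define \<mu> where "\<mu> = (\<lambda>a b. \<kappa> (m (inv_into (carrier G) \<alpha> a) (inv_into (carrier G) \<beta> b)))"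
  \<comment> \<open>The preimages chosen in the definition are harmless, since \<open>m\<close>
    depends only on \<open>\<alpha> x\<close> and \<open>\<beta> y\<close>.\<close>
  have \<mu>: "\<mu> (\<alpha> x) (\<beta> y) = \<kappa> (m x y)" if "x \<in> carrier G" "y \<in> carrier G" for x y
  proof -
    let ?x = "inv_into (carrier G) \<alpha> (\<alpha> x)" and ?y = "inv_into (carrier G) \<beta> (\<beta> y)"
    have "?x \<in> carrier G" "\<alpha> ?x = \<alpha> x" "?y \<in> carrier G" "\<beta> ?y = \<beta> y"
      using that by (simp_all add: inv_into_into f_inv_into_f)
    then have "m ?x ?y = m x y"
      using \<alpha>_cong[of ?x x ?y] \<beta>_cong[of ?y y x] that by simp
    then show ?thesis by (simp add: \<mu>_def)
  qed
  have bil: "bilinear A B C \<mu>"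
    unfolding bilinear_def
  proof (intro conjI ballI)
    fix a assume "a \<in> carrier A"
    then obtain x where x: "x \<in> carrier G" "a = \<alpha> x" unfolding A(3)[symmetric] by blast
    show "\<mu> a \<in> hom B C"
    proof (rule homI)
      fix b b' assume "b \<in> carrier B" "b' \<in> carrier B"
      then obtain y y' where y: "y \<in> carrier G" "b = \<beta> y" "y' \<in> carrier G" "b' = \<beta> y'"
        unfolding B(3)[symmetric] by blast
      have "\<mu> a (b \<otimes>\<^bsub>B\<^esub> b') = \<mu> (\<alpha> x) (\<beta> (y \<otimes> y'))" using x y by simp
      also have "\<dots> = \<kappa> (m x y \<otimes> m x y')" using \<mu>[of x "y \<otimes> y'"] x y by (simp add: m_mult_right)
      also have "\<dots> = \<mu> a b \<otimes>\<^bsub>C\<^esub> \<mu> a b'" using x y m_center by (simp add: \<mu> \<kappa>_center)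
      finally show "\<mu> a (b \<otimes>\<^bsub>B\<^esub> b') = \<mu> a b \<otimes>\<^bsub>C\<^esub> \<mu> a b'" .
    next
      fix b assume "b \<in> carrier B"
      then obtain y where "y \<in> carrier G" "b = \<beta> y" unfolding B(3)[symmetric] by blast
      then show "\<mu> a b \<in> carrier C" using x by (simp add: \<mu> \<kappa>_closed)
    qed
  next
    fix b assume "b \<in> carrier B"
    then obtain y where y: "y \<in> carrier G" "b = \<beta> y" unfolding B(3)[symmetric] by blast
    show "(\<lambda>a. \<mu> a b) \<in> hom A C"
    proof (rule homI)
      fix a a' assume "a \<in> carrier A" "a' \<in> carrier A"
      then obtain x x' where x: "x \<in> carrier G" "a = \<alpha> x" "x' \<in> carrier G" "a' = \<alpha> x'"
        unfolding A(3)[symmetric] by blast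
      have "\<mu> (a \<otimes>\<^bsub>A\<^esub> a') b = \<mu> (\<alpha> (x \<otimes> x')) (\<beta> y)" using x y by simp
      also have "\<dots> = \<kappa> (m x y \<otimes> m x' y)" using \<mu>[of "x \<otimes> x'" y] x y by (simp add: m_mult_left)
      also have "\<dots> = \<mu> a b \<otimes>\<^bsub>C\<^esub> \<mu> a' b" using x y m_center by (simp add: \<mu> \<kappa>_center)
      finally show "\<mu> (a \<otimes>\<^bsub>A\<^esub> a') b = \<mu> a b \<otimes>\<^bsub>C\<^esub> \<mu> a' b" .
    next
      fix a assume "a \<in> carrier A"
      then obtain x where "x \<in> carrier G" "a = \<alpha> x" unfolding A(3)[symmetric] by blast
      then show "\<mu> a b \<in> carrier C" using y by (simp add: \<mu> \<kappa>_closed)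
    qed
  qed
  let ?H = "heisenberg A B C \<mu>"
  have H: "group ?H" using A(1) B(1) C(1) bil by (rule group_heisenberg)
  have \<mu>_closed: "\<mu> a b \<in> carrier C" if "a \<in> carrier A" "b \<in> carrier B" for a b
    using bil that by (auto simp: bilinear_def hom_def)
  have \<mu>_one_right: "\<mu> a \<one>\<^bsub>B\<^esub> = \<one>\<^bsub>C\<^esub>" if "a \<in> carrier A" for a
    using bil that hom_one[of "\<mu> a" B C] B.is_group C.is_group by (auto simp: bilinear_def)
  have \<mu>_one_left: "\<mu> \<one>\<^bsub>A\<^esub> b = \<one>\<^bsub>C\<^esub>" if "b \<in> carrier B" for b
    using bil that hom_one[of "\<lambda>a. \<mu> a b" A C] A.is_group C.is_group by (auto simp: bilinear_def)

  \<comment> \<open>Non-degeneracy\<close>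
  have faithful_left: "a = \<one>\<^bsub>A\<^esub>" if a: "a \<in> carrier A" and \<mu>a: "\<And>b. b \<in> carrier B \<Longrightarrow> \<mu> a b = \<one>\<^bsub>C\<^esub>" for a
  proof -
    obtain x where x: "x \<in> carrier G" "a = \<alpha> x" using a unfolding A(3)[symmetric] by blast
    \<comment> \<open>Values of \<open>m\<close> are central, and \<open>\<kappa>\<close> is
      injective on the centre, so composing with \<open>\<kappa>\<close> does not enlarge the
      radical.\<close>
    have "m x y = \<one>" if y: "y \<in> carrier G" for y
      using \<kappa>_inj[OF m_center[OF x(1) y]] \<mu>a[of "\<beta> y"] \<mu>[OF x(1) y] x y by simp
    then show ?thesis using \<alpha>_one x by simp
  qed
  have faithful_right: "b = \<one>\<^bsub>B\<^esub>" if b: "b \<in> carrier B" and \<mu>b: "\<And>a. a \<in> carrier A \<Longrightarrow> \<mu> a b = \<one>\<^bsub>C\<^esub>" for b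
  proof -
    obtain y where y: "y \<in> carrier G" "b = \<beta> y" using b unfolding B(3)[symmetric] by blast
    have "m x y = \<one>" if x: "x \<in> carrier G" for x
      using \<kappa>_inj[OF m_center[OF x y(1)]] \<mu>b[of "\<alpha> x"] \<mu>[OF x y(1)] x y by simp
    then show ?thesis using \<beta>_one y by simp
  qed
  have nondeg: "nondegenerate A B C \<mu>"
    unfolding nondegenerate_def
  proof (intro equalityI subsetI)
    fix h assume "h \<in> center ?H"
    then have hH: "h \<in> carrier ?H"
      and comm: "\<And>k. k \<in> carrier ?H \<Longrightarrow> h \<otimes>\<^bsub>?H\<^esub> k = k \<otimes>\<^bsub>?H\<^esub> h"
      by (simp_all add: center_def)
    obtain a b c where h: "h = (a, b, c)" "a \<in> carrier A" "b \<in> carrier B" "c \<in> carrier C"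
      using hH by (auto simp: heisenberg_def)
    have "\<mu> a b' = \<one>\<^bsub>C\<^esub>" if "b' \<in> carrier B" for b'
    proof -
      \<comment> \<open>Commuting with an element concentrated in the second coordinate isolates
        \<open>\<mu> a b'\<close> in the third.\<close>
      have "h \<otimes>\<^bsub>?H\<^esub> (\<one>\<^bsub>A\<^esub>, b', \<one>\<^bsub>C\<^esub>) = (\<one>\<^bsub>A\<^esub>, b', \<one>\<^bsub>C\<^esub>) \<otimes>\<^bsub>?H\<^esub> h"
        using that by (intro comm) (simp add: heisenberg_def)
      then show ?thesis using h that \<mu>_closed \<mu>_one_left by (simp add: heisenberg_def)
    qed
    moreover have "\<mu> a' b = \<one>\<^bsub>C\<^esub>" if "a' \<in> carrier A" for a'
    proof -
      have "h \<otimes>\<^bsub>?H\<^esub> (a', \<one>\<^bsub>B\<^esub>, \<one>\<^bsub>C\<^esub>) = (a', \<one>\<^bsub>B\<^esub>, \<one>\<^bsub>C\<^esub>) \<otimes>\<^bsub>?H\<^esub> h"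
        using that by (intro comm) (simp add: heisenberg_def)
      then show ?thesis using h that \<mu>_closed \<mu>_one_right by (simp add: heisenberg_def)
    qed
    ultimately have "a = \<one>\<^bsub>A\<^esub>" "b = \<one>\<^bsub>B\<^esub>" using h faithful_left faithful_right by auto
    then show "h \<in> {(\<one>\<^bsub>A\<^esub>, \<one>\<^bsub>B\<^esub>, c) |c. c \<in> carrier C}" using h by simp
  next
    fix h assume "h \<in> {(\<one>\<^bsub>A\<^esub>, \<one>\<^bsub>B\<^esub>, c) |c. c \<in> carrier C}"
    then show "h \<in> center ?H"
      using \<mu>_one_left \<mu>_one_right by (auto simp: center_def heisenberg_def C.m_comm)
  qed

  \<comment> \<open>The embedding\<close>
  define \<phi> where "\<phi> = (\<lambda>x. (\<alpha> x, \<beta> x, \<kappa> x))"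
  have \<phi>_hom: "\<phi> \<in> hom G ?H"
    by (rule homI) (simp_all add: \<phi>_def heisenberg_def \<kappa>_closed \<kappa>_mult \<mu>)
  interpret \<phi>: group_hom G ?H \<phi>
    using \<phi>_hom H is_group by (simp add: group_hom_def group_hom_axioms_def)
  \<comment> \<open>An element of both radicals has trivial commutators by
    \<open>m_skew\<close>.\<close>
  have central: "x \<in> center G" if "x \<in> carrier G" "\<alpha> x = \<one>\<^bsub>A\<^esub>" "\<beta> x = \<one>\<^bsub>B\<^esub>" for x
  proof (rule commutator_eq_one_imp_center[OF that(1)])
    fix y assume y: "y \<in> carrier G"
    have "m x y = \<one>" "m y x = \<one>" using that \<alpha>_one \<beta>_one y by auto
    then show "commutator x y = \<one>" using m_skew[OF that(1) y] that(1) y by simp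
  qed
  have inj: "inj_on \<phi> (carrier G)"
  proof (subst \<phi>.inj_on_one_iff, intro allI impI)
    fix x assume x: "x \<in> carrier G" "\<phi> x = \<one>\<^bsub>?H\<^esub>"
    then have *: "\<alpha> x = \<one>\<^bsub>A\<^esub>" "\<beta> x = \<one>\<^bsub>B\<^esub>" "\<kappa> x = \<one>\<^bsub>C\<^esub>"
      by (simp_all add: \<phi>_def heisenberg_def)
    show "x = \<one>" using \<kappa>_inj[OF central[OF x(1) *(1,2)] *(3)] .
  qed
  have "\<phi> \<in> iso G (?H\<lparr>carrier := \<phi> ` carrier G\<rparr>)"
    using \<phi>_hom inj by (auto simp: iso_def bij_betw_def hom_def)
  then have embed: "\<exists>K. subgroup K ?H \<and> G \<cong> ?H\<lparr>carrier := K\<rparr>"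
    using \<phi>.img_is_subgroup is_isoI by blast

  \<comment> \<open>The chain of exponents\<close>
  have AB: "group (A \<times>\<times> B)" using A.is_group B.is_group by (rule DirProd_group)
  have powAB: "(a, b) [^]\<^bsub>A \<times>\<times> B\<^esub> k = (a [^]\<^bsub>A\<^esub> k, b [^]\<^bsub>B\<^esub> k)" for a b and k :: nat
    by (induction k) simp_all
  \<comment> \<open>A power that \<open>\<alpha>\<close> and \<open>\<beta>\<close> both kill is
    central.\<close>
  have 1: "group_exponent (G Mod center G) dvd group_exponent (A \<times>\<times> B)"
    unfolding group.group_exponent_dvd_iff[OF N.factorgroup_is_group]
  proof
    fix U assume "U \<in> carrier (G Mod center G)"
    then obtain x where x: "x \<in> carrier G" "U = center G #> x" by (auto simp: carrier_FactGroup)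
    let ?k = "group_exponent (A \<times>\<times> B)"
    have "(\<alpha> x, \<beta> x) [^]\<^bsub>A \<times>\<times> B\<^esub> ?k = \<one>\<^bsub>A \<times>\<times> B\<^esub>"
      using group.group_exponent_dvd_iff[OF AB, of ?k] x(1) by simp
    then have "\<alpha> (x [^] ?k) = \<one>\<^bsub>A\<^esub>" "\<beta> (x [^] ?k) = \<one>\<^bsub>B\<^esub>"
      using x(1) by (simp_all add: powAB \<alpha>.hom_nat_pow \<beta>.hom_nat_pow)
    then have "x [^] ?k \<in> center G" using x(1) by (intro central) auto
    then show "U [^]\<^bsub>G Mod center G\<^esub> ?k = \<one>\<^bsub>G Mod center G\<^esub>"
      using x by (simp add: N.FactGroup_pow coset_join2 subgroup_center)
  qed
  define e where "e = group_exponent ?D"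
  have powD: "z [^] e = \<one>" if "z \<in> derived G (carrier G)" for z
    using D.group_exponent_dvd_iff[of e] that nat_pow_consistent[of z e "derived G (carrier G)"]
    by (simp add: e_def)
  have m_pow_left: "m (x [^] k) y = m x y [^] k" if "x \<in> carrier G" "y \<in> carrier G" for x y and k :: nat
    using that m_center_left[OF subgroup.one_closed[OF subgroup_center]]
    by (induction k) (simp_all add: m_mult_left)
  have m_pow_right: "m y (x [^] k) = m y x [^] k" if "x \<in> carrier G" "y \<in> carrier G" for x y and k :: nat
    using that m_center_right[OF subgroup.one_closed[OF subgroup_center]]
    by (induction k) (simp_all add: m_mult_right)
  \<comment> \<open>\<open>m\<close> has its values in the derived subgroup, so \<open>e\<close>-th
    powers lie in both radicals.\<close>
  have 2: "group_exponent (A \<times>\<times> B) dvd e"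
    unfolding group.group_exponent_dvd_iff[OF AB]
  proof
    fix p assume "p \<in> carrier (A \<times>\<times> B)"
    then have "fst p \<in> \<alpha> ` carrier G" "snd p \<in> \<beta> ` carrier G" using A(3) B(3) by auto
    then obtain x y where xy: "x \<in> carrier G" "y \<in> carrier G" "p = (\<alpha> x, \<beta> y)"
      by (metis imageE prod.collapse)
    have "\<alpha> (x [^] e) = \<one>\<^bsub>A\<^esub>" using xy by (subst \<alpha>_one) (simp_all add: m_pow_left powD m_derived)
    moreover have "\<beta> (y [^] e) = \<one>\<^bsub>B\<^esub>" using xy by (subst \<beta>_one) (simp_all add: m_pow_right powD m_derived)
    ultimately show "p [^]\<^bsub>A \<times>\<times> B\<^esub> e = \<one>\<^bsub>A \<times>\<times> B\<^esub>"
      using xy by (simp add: powAB \<alpha>.hom_nat_pow \<beta>.hom_nat_pow)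
  qed
  have powZ: "z [^]\<^bsub>?Z\<^esub> k = z [^] k" for z and k :: nat
    using nat_pow_consistent[of z k "center G"] by simp
  have 3: "e dvd group_exponent ?Z"
    unfolding e_def D.group_exponent_dvd_iff
  proof
    fix z assume z: "z \<in> carrier ?D"
    then have "z [^]\<^bsub>?Z\<^esub> group_exponent ?Z = \<one>"
      using Z.group_exponent_dvd_iff[of "group_exponent ?Z"] derived_subset_center by auto
    then show "z [^]\<^bsub>?D\<^esub> group_exponent ?Z = \<one>\<^bsub>?D\<^esub>"
      using powZ nat_pow_consistent[of z _ "derived G (carrier G)"] by simp
  qed
  have 4: "group_exponent ?Z dvd group_exponent C"
    unfolding Z.group_exponent_dvd_iff
  proof
    fix z assume "z \<in> carrier ?Z"
    then have z: "z \<in> center G" by simp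
    have zk: "z [^] k \<in> center G" for k :: nat
      using subgroup_int_pow_closed[OF subgroup_center z, of "int k"] by (simp add: int_pow_int)
    \<comment> \<open>\<open>\<kappa>\<close> is a homomorphism on \<open>untwist\<close>, not on
      \<open>G\<close>; for powers of a central element the products agree.\<close>
    have "\<kappa> (z [^] k) = \<kappa> z [^]\<^bsub>C\<^esub> k" for k :: nat
    proof (induction k)
      case (Suc k)
      then show ?case using \<kappa>_center[OF zk[of k] centerD(1)[OF z]] by simp
    qed (use \<kappa>.hom_one in simp)
    moreover have "\<kappa> z [^]\<^bsub>C\<^esub> group_exponent C = \<one>\<^bsub>C\<^esub>"
      using C.group_exponent_dvd_iff[of "group_exponent C"] \<kappa>_closed[OF centerD(1)[OF z]] by simp
    ultimately have "z [^] group_exponent C = \<one>" using \<kappa>_inj[OF zk] by simp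
    then show "z [^]\<^bsub>?Z\<^esub> group_exponent C = \<one>\<^bsub>?Z\<^esub>" using powZ by simp
  qed
  have 5: "group_exponent C dvd group_exponent G"
    using powC unfolding C.group_exponent_dvd_iff n_def by blast
  show ?thesis
    using A(1) B(1) C(1) bil nondeg embed rankA rankB rankC 1 2 3 4 5 unfolding e_def
    by (intro exI[of _ A] exI[of _ B] exI[of _ C] exI[of _ \<mu>] conjI) simp_all
qed

end

theorem theorem2:
  fixes G :: "('a, 'm) monoid_scheme"
  assumes "group G" and "finite (carrier G)"
    and "nilpotent G" and "nilpotency_class G \<le> 2"
  shows "\<exists>(A :: nat monoid) (B :: nat monoid) (C :: nat monoid) (\<mu> :: nat \<Rightarrow> nat \<Rightarrow> nat).
    comm_group A \<and> comm_group B \<and> comm_group C \<and> bilinear A B C \<mu> \<and>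
    nondegenerate A B C \<mu> \<and>
    (\<exists>K. subgroup K (heisenberg A B C \<mu>) \<and> G \<cong> (heisenberg A B C \<mu>)\<lparr>carrier := K\<rparr>) \<and>
    gen_rank (G Mod center G) \<ge> max (gen_rank A) (gen_rank B) \<and>
    gen_rank (G\<lparr>carrier := center G\<rparr>) = gen_rank C \<and>
    group_exponent (G Mod center G) dvd group_exponent (A \<times>\<times> B) \<and>
    group_exponent (A \<times>\<times> B) dvd group_exponent (G\<lparr>carrier := derived G (carrier G)\<rparr>) \<and>
    group_exponent (G\<lparr>carrier := derived G (carrier G)\<rparr>)
      dvd group_exponent (G\<lparr>carrier := center G\<rparr>) \<and>
    group_exponent (G\<lparr>carrier := center G\<rparr>) dvd group_exponent C \<and>
    group_exponent C dvd group_exponent G"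
proof -
  interpret class2_group G using assms(3,4) by (rule class2_groupI)
  obtain m where "polarised_group G m" using assms(2) by (rule polarisation)
  then show ?thesis using assms(2) by (rule polarised_group.heisenberg_embedding)
qed

end
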